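(* Let $\mathcal F$ be an algebraically closed and inversive $\sigma$-field of characteristic zero and $\mathcal I=\mathcal I(\rho)=[\mathbb Y^{\mathbf f}-\rho(\mathbf f)\mid\mathbf f\in L_\rho]\subset\mathcal F\{\mathbb Y^\pm\}$ a Laurent binomial $\sigma$-ideal, where $\rho$ is a partial character on $\mathbb Z[x]^n$. Then the well-mixed closure of $\mathcal I$ is either $[1]$ or a Laurent binomial $\sigma$-ideal whose support lattice is $\mathrm{sat}_M(L_\rho)$.
   Context: A $\sigma$-field is a field $\mathcal F$ with a ring endomorphism $\sigma$ with $\sigma(a)=0$ iff $a=0$; inversive means $\sigma$ bijective. $\mathbb Y=\{y_1,\ldots,y_n\}$ are difference indeterminates. For $p=\sum_i c_ix^i\in\mathbb Z[x]$, $a^p:=\prod_i\sigma^i(a)^{c_i}$; for $\mathbf f\in\mathbb Z[x]^n$, $\mathbb Y^{\mathbf f}:=\prod_iy_i^{f_i}$. $\mathcal F\{\mathbb Y^\pm\}$ is the ring of Laurent difference polynomials (finite $\mathcal F$-linear combinations of the $\mathbb Y^{\mathbf f}$). A $\sigma$-ideal is an ideal closed under $\sigma$; $[S]$ is the $\sigma$-ideal generated by $S$. A Laurent binomial $\sigma$-ideal is one generated by elements $a\mathbb Y^{\mathbf g}+b\mathbb Y^{\mathbf h}$, $a,b\in\mathcal F$; its support lattice is $\{\mathbf f\in\mathbb Z[x]^n\mid\exists c\in\mathcal F\setminus\{0\},\ \mathbb Y^{\mathbf f}-c\in\mathcal I\}$. A partial character $\rho$ on $\mathbb Z[x]^n$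 is a homomorphism from a $\mathbb Z[x]$-submodule ($\mathbb Z[x]$-lattice) $L_\rho\subset\mathbb Z[x]^n$ to the multiplicative group $\mathcal F\setminus\{0\}$ with $\rho(x\mathbf f)=\sigma(\rho(\mathbf f))$. A $\sigma$-ideal $\mathcal I$ is well-mixed if $fg\in\mathcal I$ implies $f\sigma(g)\in\mathcal I$; the well-mixed closure is the smallest well-mixed $\sigma$-ideal containing $\mathcal I$. For $m\ge2$ let $\zeta_m=e^{2\pi\mathrm i/m}\in\mathcal F$ be the primitive $m$-th root of unity and $o_m\in\{0,\ldots,m-1\}$ the number with $\sigma(\zeta_m)=\zeta_m^{o_m}$; $o_1=0$. A $\mathbb Z[x]$-lattice $L$ is M-saturated if $m\mathbf f\in L$ implies $(x-o_m)\mathbf f\in L$ for all integers $m\ge1$ and $\mathbf f\in\mathbb Z[x]^n$; $\mathrm{sat}_M(L)$ is the smallest M-saturated $\mathbb Z[x]$-lattice containing $L$. *)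

theory Defs
  imports
    "HOL-Analysis.Analysis"
    "HOL-Computational_Algebra.Computational_Algebra"
    "HOL-Library.Poly_Mapping"
begin

section \<open>Difference fields\<close>

definition difference_field :: "('a::field \<Rightarrow> 'a) \<Rightarrow> bool" where
  "difference_field \<sigma> \<longleftrightarrow>
     (\<forall>a b. \<sigma> (a + b) = \<sigma> a + \<sigma> b) \<and> (\<forall>a b. \<sigma> (a * b) = \<sigma> a * \<sigma> b) \<and>
     \<sigma> 1 = 1 \<and> (\<forall>a. \<sigma> a = 0 \<longleftrightarrow> a = 0)"

definition inversive :: "('a::field \<Rightarrow> 'a) \<Rightarrow> bool" where
  "inversive \<sigma> \<longleftrightarrow> bij \<sigma>"

section \<open>Lattices in the module of integer polynomial vectors\<close>

interpretation ring_module: module "(*) :: 'r::comm_ring_1 \<Rightarrow> 'r \<Rightarrow> 'r"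
  by unfold_locales (simp_all add: algebra_simps)

interpretation vec_module: module "(*s) :: 'r::comm_ring_1 \<Rightarrow> 'r ^ 'n \<Rightarrow> 'r ^ 'n"
  by unfold_locales (simp_all add: vec_eq_iff algebra_simps)

definition zx_lattice :: "(int poly ^ 'n) set \<Rightarrow> bool" where
  "zx_lattice L \<longleftrightarrow> vec_module.subspace L"

abbreviation shift :: "int poly ^ 'n \<Rightarrow> int poly ^ 'n" where
  "shift f \<equiv> [:0, 1:] *s f"

definition partial_character ::
  "('a::field \<Rightarrow> 'a) \<Rightarrow> (int poly ^ 'n) set \<Rightarrow> (int poly ^ 'n \<Rightarrow> 'a) \<Rightarrow> bool" where
  "partial_character \<sigma> L \<rho> \<longleftrightarrow>
     zx_lattice L \<and>
     (\<forall>f\<in>L. \<rho> f \<noteq> 0) \<and>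
     (\<forall>f\<in>L. \<forall>g\<in>L. \<rho> (f + g) = \<rho> f * \<rho> g) \<and>
     (\<forall>f\<in>L. \<rho> (shift f) = \<sigma> (\<rho> f))"

section \<open>Laurent difference polynomials\<close>

text \<open>
  The Laurent difference polynomial ring in the indeterminates \<open>y\<^sub>i\<close>, \<open>i :: 'n\<close>, is the group
  algebra of the additive group \<open>int poly ^ 'n\<close>: the finitely supported function \<open>p\<close> stands
  for the sum of the terms \<open>lookup p f\<close> times the monomial with exponent vector \<open>f\<close>, and the
  multiplication of \<^type>\<open>poly_mapping\<close> is convolution with respect to addition of exponents.
\<close>

type_synonym ('a, 'n) laurent = "(int poly ^ 'n) \<Rightarrow>\<^sub>0 'a"

abbreviation lmonom :: "'a::zero \<Rightarrow> int poly ^ 'n \<Rightarrow> ('a, 'n::finite) laurent" where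
  "lmonom a f \<equiv> Poly_Mapping.single f a"

abbreviation lconst :: "'a::zero \<Rightarrow> ('a, 'n::finite) laurent" where
  "lconst c \<equiv> lmonom c 0"

definition laurent_sigma ::
  "('a::field \<Rightarrow> 'a) \<Rightarrow> ('a, 'n::finite) laurent \<Rightarrow> ('a, 'n::finite) laurent" where
  "laurent_sigma \<sigma> p =
     (\<Sum>f\<in>Poly_Mapping.keys p. lmonom (\<sigma> (Poly_Mapping.lookup p f)) (shift f))"

lemma laurent_sigma_lmonom:
  assumes "difference_field \<sigma>"
  shows "laurent_sigma \<sigma> (lmonom a f) = lmonom (\<sigma> a) (shift f)"
proof -
  have "\<sigma> 0 = 0" using assms by (simp add: difference_field_def)
  then show ?thesis by (cases "a = 0") (simp_all add: laurent_sigma_def)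
qed

section \<open>Difference ideals\<close>

definition sigma_ideal ::
  "('a::field \<Rightarrow> 'a) \<Rightarrow> ('a, 'n::finite) laurent set \<Rightarrow> bool" where
  "sigma_ideal \<sigma> I \<longleftrightarrow> ring_module.subspace I \<and> (\<forall>p\<in>I. laurent_sigma \<sigma> p \<in> I)"

definition sigma_ideal_generated ::
  "('a::field \<Rightarrow> 'a) \<Rightarrow> ('a, 'n::finite) laurent set \<Rightarrow> ('a, 'n::finite) laurent set" where
  "sigma_ideal_generated \<sigma> S = sigma_ideal \<sigma> hull S"

definition laurent_binomial_sigma_ideal ::
  "('a::field \<Rightarrow> 'a) \<Rightarrow> ('a, 'n::finite) laurent set \<Rightarrow> bool" where
  "laurent_binomial_sigma_ideal \<sigma> I \<longleftrightarrow>
     (\<exists>B. B \<subseteq> {lmonom a g + lmonom b h | a b g h. True} \<and> I = sigma_ideal_generated \<sigma> B)"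

definition support_lattice :: "('a::field, 'n::finite) laurent set \<Rightarrow> (int poly ^ 'n) set" where
  "support_lattice I = {f. \<exists>c. c \<noteq> 0 \<and> lmonom 1 f - lconst c \<in> I}"

definition character_ideal ::
  "('a::field \<Rightarrow> 'a) \<Rightarrow> (int poly ^ 'n) set \<Rightarrow> (int poly ^ 'n \<Rightarrow> 'a) \<Rightarrow> ('a, 'n::finite) laurent set" where
  "character_ideal \<sigma> L \<rho> = sigma_ideal_generated \<sigma> ((\<lambda>f. lmonom 1 f - lconst (\<rho> f)) ` L)"

definition well_mixed ::
  "('a::field \<Rightarrow> 'a) \<Rightarrow> ('a, 'n::finite) laurent set \<Rightarrow> bool" where
  "well_mixed \<sigma> I \<longleftrightarrow>
     sigma_ideal \<sigma> I \<and> (\<forall>p q. p * q \<in> I \<longrightarrow> p * laurent_sigma \<sigma> q \<in> I)"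

definition well_mixed_closure ::
  "('a::field \<Rightarrow> 'a) \<Rightarrow> ('a, 'n::finite) laurent set \<Rightarrow> ('a, 'n::finite) laurent set" where
  "well_mixed_closure \<sigma> I = well_mixed \<sigma> hull I"

section \<open>M-saturation\<close>

definition primitive_root_of_unity :: "nat \<Rightarrow> 'a::field \<Rightarrow> bool" where
  "primitive_root_of_unity m z \<longleftrightarrow> z ^ m = 1 \<and> (\<forall>k. 0 < k \<and> k < m \<longrightarrow> z ^ k \<noteq> 1)"

text \<open>
  In an abstract field the root \<open>exp (2 \<pi> \<i> / m)\<close> is rendered by a parameter: \<open>\<zeta> m\<close> is the chosen
  primitive \<open>m\<close>-th root of unity. The number \<open>o\<^sub>m\<close> does not depend on the choice, since all
  \<open>m\<close>-th roots of unity are powers of a primitive one.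
\<close>

definition root_exponent :: "('a::field \<Rightarrow> 'a) \<Rightarrow> (nat \<Rightarrow> 'a) \<Rightarrow> nat \<Rightarrow> nat" where
  "root_exponent \<sigma> \<zeta> m = (if m = 1 then 0 else (THE k. k < m \<and> \<sigma> (\<zeta> m) = \<zeta> m ^ k))"

lemma root_exponent_ex1:
  fixes \<sigma> :: "'a::field \<Rightarrow> 'a"
  assumes "difference_field \<sigma>" "m \<ge> 1" "primitive_root_of_unity m z"
  shows "\<exists>!k. k < m \<and> \<sigma> z = z ^ k"
proof -
  have z: "z ^ m = 1" and prim: "\<And>k. 0 < k \<Longrightarrow> k < m \<Longrightarrow> z ^ k \<noteq> 1"
    using assms(3) by (auto simp: primitive_root_of_unity_def)
  have z0: "z \<noteq> 0" using z assms(2) by (auto simp: power_0_left)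
  have neq: "z ^ i \<noteq> z ^ j" if "i < j" "j < m" for i j
  proof
    assume "z ^ i = z ^ j"
    moreover have "z ^ j = z ^ i * z ^ (j - i)"
      using that by (simp flip: power_add)
    ultimately have "z ^ (j - i) = 1" using z0 by simp
    moreover have "0 < j - i" "j - i < m" using that by linarith+
    ultimately show False using prim by blast
  qed
  have inj: "inj_on (\<lambda>k. z ^ k) {..<m}"
  proof (rule inj_onI)
    fix i j assume "z ^ i = z ^ j" "i \<in> {..<m}" "j \<in> {..<m}"
    then show "i = j" using neq[of i j] neq[of j i] by (cases i j rule: linorder_cases) auto
  qed
  define R where "R = {w::'a. w ^ m = 1}"
  have "finite R \<and> card R \<le> m"
  proof -
    let ?p = "Polynomial.monom (1::'a) m - 1"
    have "coeff ?p m = 1" using assms(2) by simp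
    then have p0: "?p \<noteq> 0" by (metis coeff_0 zero_neq_one)
    have R: "R = {w. poly ?p w = 0}" by (auto simp: R_def poly_monom)
    have "degree ?p \<le> m" by (intro degree_diff_le) (auto simp: degree_monom_le)
    with card_poly_roots_bound[OF p0] poly_roots_finite[OF p0] show ?thesis
      unfolding R by linarith
  qed
  moreover have "(\<lambda>k. z ^ k) ` {..<m} \<subseteq> R"
  proof (rule image_subsetI)
    fix k
    have "(z ^ k) ^ m = (z ^ m) ^ k" by (simp only: power_mult[symmetric] mult.commute)
    then show "z ^ k \<in> R" using z by (simp add: R_def)
  qed
  ultimately have R: "(\<lambda>k. z ^ k) ` {..<m} = R"
    by (intro card_seteq) (auto simp: card_image[OF inj])
  have pow: "\<sigma> (z ^ k) = \<sigma> z ^ k" for k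
    by (induction k) (use assms(1) in \<open>auto simp: difference_field_def\<close>)
  have "\<sigma> 1 = 1" using assms(1) by (simp add: difference_field_def)
  with pow[of m] z have "\<sigma> z ^ m = 1" by simp
  then have "\<sigma> z \<in> R" by (simp add: R_def)
  then obtain k where "k < m" "\<sigma> z = z ^ k" unfolding R[symmetric] by auto
  moreover from this have "j = k" if "j < m" "\<sigma> z = z ^ j" for j
    using inj_onD[OF inj, of j k] that by simp
  ultimately show ?thesis by blast
qed

definition M_saturated ::
  "('a::field \<Rightarrow> 'a) \<Rightarrow> (nat \<Rightarrow> 'a) \<Rightarrow> (int poly ^ 'n) set \<Rightarrow> bool" where
  "M_saturated \<sigma> \<zeta> L \<longleftrightarrow>
     (\<forall>m\<ge>1. \<forall>f. of_nat m *s f \<in> L \<longrightarrow>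
        ([:0, 1:] - of_nat (root_exponent \<sigma> \<zeta> m)) *s f \<in> L)"

definition sat_M ::
  "('a::field \<Rightarrow> 'a) \<Rightarrow> (nat \<Rightarrow> 'a) \<Rightarrow> (int poly ^ 'n) set \<Rightarrow> (int poly ^ 'n) set" where
  "sat_M \<sigma> \<zeta> L = (\<lambda>K. zx_lattice K \<and> M_saturated \<sigma> \<zeta> K) hull L"

end

theory Submission
  imports Defs
begin

text \<open>
  The exponent vectors form the abelian group \<open>G = \<int>[x]\<^sup>n\<close>, and the Laurent difference polynomials
  are its group algebra over the field \<open>F\<close>. Let \<open>J\<close> be the well-mixed closure, and suppose that it
  does not contain \<open>1\<close>. Then a monomial \<open>Y\<^sup>f\<close> is congruent modulo \<open>J\<close> to at most one constant, so
  that \<open>J\<close> defines a partial character on its support lattice.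
  
  The support lattice contains the M-saturation \<open>S\<close> of \<open>L\<close>, because it is itself M-saturated. More
  precisely, if \<open>Y\<^sup>m\<^sup>f\<close> is congruent to \<open>b\<^sup>m\<close>, then \<open>Y\<^sup>(\<^sup>x\<^sup>-\<^sup>o\<^sup>)\<^sup>f\<close> with \<open>o = o\<^sub>m\<close> is congruent to
  \<open>\<sigma> b / b\<^sup>o\<close> (\<open>well_mixed_binomial_root\<close>): well-mixedness can be applied to the factorization of
  \<open>u\<^sup>m - b\<^sup>m\<close> into linear factors in \<open>u = Y\<^sup>f\<close>. This yields not only the exponents but also a
  compatibility between the values of the partial character and \<open>\<sigma>\<close>.
  
  Conversely, the binomials of \<open>J\<close> with exponents in \<open>S\<close> generate an ideal \<open>D\<close> inside \<open>J\<close> whose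
  support lattice is \<open>S\<close>, and it has to be shown that \<open>D\<close> is already well-mixed
  (\<open>well_mixed_twisted_kernel\<close>). Let \<open>T\<close> be the set of exponents with a positive multiple in \<open>S\<close>.
  As \<open>F\<^sup>*\<close> is divisible, the values on \<open>S\<close> extend to characters \<open>\<eta>\<close> of \<open>G\<close>. The binomial ideal of \<open>\<eta>\<close>
  on \<open>T\<close> is prime, since the quotient by it is a group algebra of the torsion-free group \<open>G / T\<close>
  (\<open>twisted_kernel_prime\<close>), and the compatibility says that \<open>\<eta>\<close> commutes with \<open>\<sigma>\<close> on \<open>T\<close>, so that this
  ideal is \<open>\<sigma>\<close>-stable. A \<open>\<sigma>\<close>-stable prime ideal is well-mixed. Finally \<open>D\<close> is the intersection of
  these ideals, because the characters that are trivial on \<open>S\<close> separate the points of \<open>G / S\<close>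
  (\<open>twisted_kernel_from_characters\<close>).
\<close>

(* Oriented against mult.assoc, with which it loops. *)
declare ring_module.scale_scale [simp del]

section \<open>Characters of abelian groups\<close>

definition add_subgroup :: "'g::ab_group_add set \<Rightarrow> bool" where
  "add_subgroup T \<longleftrightarrow> 0 \<in> T \<and> (\<forall>f\<in>T. \<forall>g\<in>T. f - g \<in> T)"

lemma add_subgroupD:
  assumes "add_subgroup T"
  shows "0 \<in> T" and "f \<in> T \<Longrightarrow> g \<in> T \<Longrightarrow> f - g \<in> T"
    and "f \<in> T \<Longrightarrow> g \<in> T \<Longrightarrow> f + g \<in> T" and "f \<in> T \<Longrightarrow> - f \<in> T"
proof -
  show 0: "0 \<in> T" and d: "f \<in> T \<Longrightarrow> g \<in> T \<Longrightarrow> f - g \<in> T" for f g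
    using assms by (auto simp: add_subgroup_def)
  show m: "f \<in> T \<Longrightarrow> - f \<in> T" for f using d[OF 0] by fastforce
  show "f \<in> T \<Longrightarrow> g \<in> T \<Longrightarrow> f + g \<in> T" using d[of f "- g"] m[of g] by simp
qed

lemma add_subgroup_UNIV: "add_subgroup UNIV"
  by (simp add: add_subgroup_def)

definition character_on :: "'g::ab_group_add set \<Rightarrow> ('g \<Rightarrow> 'a::field) \<Rightarrow> bool" where
  "character_on S \<rho> \<longleftrightarrow> (\<forall>f\<in>S. \<rho> f \<noteq> 0) \<and> (\<forall>f\<in>S. \<forall>g\<in>S. \<rho> (f + g) = \<rho> f * \<rho> g)"

abbreviation character :: "('g::ab_group_add \<Rightarrow> 'a::field) \<Rightarrow> bool" where
  "character \<equiv> character_on UNIV"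

lemma character_on_0:
  assumes "character_on S \<rho>" "0 \<in> S" shows "\<rho> 0 = 1"
proof -
  have "\<rho> (0 + 0) = \<rho> 0 * \<rho> 0" "\<rho> 0 \<noteq> 0"
    using assms unfolding character_on_def by blast+
  then show ?thesis by simp
qed

lemma character_on_diff:
  assumes "character_on S \<rho>" "add_subgroup S" "f \<in> S" "g \<in> S"
  shows "\<rho> (f - g) = \<rho> f / \<rho> g"
proof -
  have "\<rho> (f - g) * \<rho> g = \<rho> (f - g + g)"
    using assms by (metis add_subgroupD(2) character_on_def)
  then show ?thesis using assms by (simp add: character_on_def field_simps)
qed

lemma characterD:
  assumes "character \<psi>"
  shows "\<psi> f \<noteq> 0" "\<psi> (f + g) = \<psi> f * \<psi> g" "\<psi> 0 = 1" "\<psi> (f - g) = \<psi> f / \<psi> g"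
  using assms character_on_0[OF assms] character_on_diff[OF assms add_subgroup_UNIV, of f g]
  by (auto simp: character_on_def)

lemma character_of_nat_scale:
  fixes \<psi> :: "'r::comm_ring_1 ^ 'n \<Rightarrow> 'a::field"
  assumes "character \<psi>"
  shows "\<psi> (of_nat m *s f) = \<psi> f ^ m"
  by (induction m) (simp_all add: characterD[OF assms] vec_module.scale_left_distrib)

text \<open>
  Partial characters are extended by Zorn's lemma. Representing them by their graphs, as
  subgroups of \<open>G \<times> F\<^sup>*\<close> that meet \<open>0 \<times> F\<^sup>*\<close> trivially, makes the upper bound of a
  chain a plain union.
\<close>

definition partial_character_graph :: "('g::ab_group_add \<times> 'a::field) set \<Rightarrow> bool" where
  "partial_character_graph H \<longleftrightarrow>
     (0, 1) \<in> H \<and> (\<forall>f a g b. (f, a) \<in> H \<longrightarrow> (g, b) \<in> H \<longrightarrow> (f - g, a / b) \<in> H) \<and>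
     (\<forall>f a. (f, a) \<in> H \<longrightarrow> a \<noteq> 0) \<and> (\<forall>a. (0, a) \<in> H \<longrightarrow> a = 1)"

lemma partial_character_graphD:
  assumes "partial_character_graph H"
  shows "(0, 1) \<in> H" "(f, a) \<in> H \<Longrightarrow> (g, b) \<in> H \<Longrightarrow> (f - g, a / b) \<in> H"
    "(f, a) \<in> H \<Longrightarrow> a \<noteq> 0" "(0, a) \<in> H \<Longrightarrow> a = 1"
    "(f, a) \<in> H \<Longrightarrow> (- f, inverse a) \<in> H" "(f, a) \<in> H \<Longrightarrow> (g, b) \<in> H \<Longrightarrow> (f + g, a * b) \<in> H"
    "(f, a) \<in> H \<Longrightarrow> (f, b) \<in> H \<Longrightarrow> a = b"
proof -
  show z: "(0, 1) \<in> H" and d: "\<And>f a g b. (f, a) \<in> H \<Longrightarrow> (g, b) \<in> H \<Longrightarrow> (f - g, a / b) \<in> H"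
   and nz: "\<And>f a. (f, a) \<in> H \<Longrightarrow> a \<noteq> 0" and o: "\<And>a. (0, a) \<in> H \<Longrightarrow> a = 1"
    using assms unfolding partial_character_graph_def by blast+
  show m: "(f, a) \<in> H \<Longrightarrow> (- f, inverse a) \<in> H" for f a
    using d[OF z, of f a] by (simp add: inverse_eq_divide)
  show "(f, a) \<in> H \<Longrightarrow> (g, b) \<in> H \<Longrightarrow> (f + g, a * b) \<in> H"
    using d[of f a "- g" "inverse b"] m[of g b] by (simp add: divide_inverse)
  show "a = b" if "(f, a) \<in> H" "(f, b) \<in> H"
    using d[OF that] o nz[OF that(2)] by fastforce
qed

lemma partial_character_graph_scale:
  fixes H :: "(('r::comm_ring_1 ^ 'n) \<times> 'a::field) set"
  assumes H: "partial_character_graph H" and "(f, a) \<in> H"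
  shows "(of_int k *s f, a powi k) \<in> H"
proof -
  have nat: "(of_nat n *s f, a ^ n) \<in> H" for n
  proof (induction n)
    case 0
    then show ?case using partial_character_graphD(1)[OF H] by simp
  next
    case (Suc n)
    from partial_character_graphD(6)[OF H assms(2) this]
    show ?case by (simp add: vec_module.scale_left_distrib)
  qed
  show ?thesis
  proof (cases "k \<ge> 0")
    case True
    then obtain n where "k = int n" using nonneg_int_cases by blast
    then show ?thesis using nat by simp
  next
    case False
    then obtain n where "k = - int n" by (metis nonpos_int_cases linear)
    then show ?thesis using partial_character_graphD(5)[OF H nat[of n]] by (simp add: power_int_minus)
  qed
qed

text \<open>
  A partial character extends to one more element \<open>g\<close> with value \<open>d\<close> as soon as \<open>d\<close> is
  consistent with the values already given to the multiples of \<open>g\<close>.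
\<close>

lemma partial_character_graph_adjoin:
  fixes H :: "(('r::comm_ring_1 ^ 'n) \<times> 'a::field) set"
  assumes H: "partial_character_graph H" and d: "d \<noteq> 0"
    and compat: "\<And>k a. (of_int k *s g, a) \<in> H \<Longrightarrow> a = d powi k"
  obtains H' where "partial_character_graph H'" "H \<subseteq> H'" "(g, d) \<in> H'"
proof
  define H' where "H' = {(f + of_int k *s g, a * d powi k) | f a k. (f, a) \<in> H}"
  note HD = partial_character_graphD[OF H]
  show "H \<subseteq> H'"
  proof
    fix x assume "x \<in> H"
    then obtain f a where x: "x = (f, a)" "(f, a) \<in> H" by (cases x) auto
    then show "x \<in> H'" unfolding H'_def by (intro CollectI exI[of _ f] exI[of _ a] exI[of _ 0]) simp
  qed
  show "(g, d) \<in> H'"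
    unfolding H'_def using HD(1) by (intro CollectI exI[of _ 0] exI[of _ 1] exI[of _ 1]) simp
  show "partial_character_graph H'"
    unfolding partial_character_graph_def
  proof (intro conjI allI impI)
    show "(0, 1) \<in> H'" using \<open>H \<subseteq> H'\<close> HD(1) by blast
  next
    fix f a f' a' assume "(f, a) \<in> H'" "(f', a') \<in> H'"
    then obtain e b k e' b' k' where *: "f = e + of_int k *s g" "a = b * d powi k" "(e, b) \<in> H"
       "f' = e' + of_int k' *s g" "a' = b' * d powi k'" "(e', b') \<in> H"
      unfolding H'_def by blast
    have "f - f' = (e - e') + of_int (k - k') *s g"
      by (simp add: * vec_module.scale_left_diff_distrib)
    moreover have "a / a' = (b / b') * d powi (k - k')" using d by (simp add: * power_int_diff)
    ultimately show "(f - f', a / a') \<in> H'" unfolding H'_def using HD(2)[OF *(3,6)] by blast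
  next
    fix f a assume "(f, a) \<in> H'"
    then show "a \<noteq> 0" unfolding H'_def using HD(3) d by auto
  next
    fix a assume "(0, a) \<in> H'"
    then obtain e b k where *: "0 = e + of_int k *s g" "a = b * d powi k" "(e, b) \<in> H"
      unfolding H'_def by blast
    have "e = of_int (- k) *s g" using *(1) by (simp add: eq_neg_iff_add_eq_0)
    then have "b = d powi (- k)" using compat[of "- k"] *(3) by simp
    then show "a = 1" using *(2) d by (simp add: power_int_minus)
  qed
qed

lemma nontrivial_root_of_unity_exists:
  assumes "n \<ge> 2"
  shows "\<exists>z::'a::{alg_closed_field, field_char_0}. z ^ n = 1 \<and> z \<noteq> 1"
proof -
  obtain z :: 'a where z: "(\<Sum>k\<le>n - 1. 1 * z ^ k) = 0"
    using alg_closed[of "n - 1" "\<lambda>_. 1::'a"] assms by auto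
  moreover have "{..n - 1} = {..<n}" using assms by auto
  ultimately have s: "(\<Sum>k<n. z ^ k) = 0" by simp
  then have "z ^ n = 1" using power_diff_1_eq[of z n] by simp
  moreover have "z \<noteq> 1" using s assms by auto
  ultimately show ?thesis by blast
qed

text \<open>
  If no nonzero multiple of \<open>g\<close> has a value yet, any \<open>d \<noteq> 0\<close> is consistent. Otherwise the
  multiples of \<open>g\<close> in the domain are those of a least \<open>n g\<close>, and \<open>d\<close> may be any \<open>n\<close>-th root of
  the value of \<open>n g\<close>. Since \<open>g\<close> itself has no value, \<open>n \<ge> 2\<close> and there are at least two roots;
  the freedom to avoid \<open>1\<close> is what makes characters separate points.
\<close>

lemma partial_character_graph_new_value:
  fixes H :: "(('r::comm_ring_1 ^ 'n) \<times> 'a::{alg_closed_field, field_char_0}) set"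
  assumes H: "partial_character_graph H" and g: "g \<notin> Domain H"
  obtains d where "d \<noteq> 0" "d \<noteq> 1" "\<And>k a. (of_int k *s g, a) \<in> H \<Longrightarrow> a = d powi k"
proof (cases "\<exists>k>0. of_int k *s g \<in> Domain H")
  case False
  have "k = 0" if "(of_int k *s g, a) \<in> H" for k a
  proof (rule ccontr)
    assume "k \<noteq> 0"
    have "(of_int (- k) *s g, inverse a) \<in> H" using partial_character_graphD(5)[OF H that] by simp
    with that False \<open>k \<noteq> 0\<close> show False by (metis Domain.DomainI linorder_neqE neg_0_less_iff_less)
  qed
  then show thesis using partial_character_graphD(4)[OF H] by (intro that[of 2]) force+
next
  case True
  define n where "n = (LEAST n. n > 0 \<and> of_int (int n) *s g \<in> Domain H)"
  have n: "n > 0" "of_int (int n) *s g \<in> Domain H"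
    and least: "\<And>j. j > 0 \<Longrightarrow> of_int (int j) *s g \<in> Domain H \<Longrightarrow> n \<le> j"
  proof -
    have "\<exists>n>0. of_int (int n) *s g \<in> Domain H" using True by (metis zero_less_imp_eq_int)
    then have "n > 0 \<and> of_int (int n) *s g \<in> Domain H"
      unfolding n_def by (rule LeastI_ex)
    then show "n > 0" "of_int (int n) *s g \<in> Domain H" by auto
    show "\<And>j. j > 0 \<Longrightarrow> of_int (int j) *s g \<in> Domain H \<Longrightarrow> n \<le> j"
      unfolding n_def by (rule Least_le) simp
  qed
  have "n \<noteq> 1" using n(2) g by auto
  with n(1) have n2: "n \<ge> 2" by linarith
  obtain c where c: "(of_int (int n) *s g, c) \<in> H" using n(2) by blast
  obtain z :: 'a where z: "z ^ n = 1" "z \<noteq> 1" using nontrivial_root_of_unity_exists[OF n2] by blast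
  obtain d0 where d0: "d0 ^ n = c" using nth_root_exists[OF n(1)] by blast
  obtain d where d: "d ^ n = c" "d \<noteq> 1"
  proof (cases "d0 = 1")
    case True
    then show thesis using that[of z] z d0 by simp
  qed (use that d0 in blast)
  have d0: "d \<noteq> 0" using d(1) n(1) partial_character_graphD(3)[OF H c] by (auto simp: power_0_left)
  show thesis
  proof (rule that[OF d0 d(2)])
    fix k a assume ka: "(of_int k *s g, a) \<in> H"
    define q r where "q = k div int n" and "r = k mod int n"
    have k: "k = q * int n + r" unfolding q_def r_def by simp
    have "(of_int q *s (of_int (int n) *s g), c powi q) \<in> H"
      by (rule partial_character_graph_scale[OF H c])
    then have cq: "(of_int (q * int n) *s g, c powi q) \<in> H" by simp
    from partial_character_graphD(2)[OF H ka this]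
    have "(of_int r *s g, a / c powi q) \<in> H"
      by (simp add: k flip: vec_module.scale_left_diff_distrib)
    moreover have "0 \<le> r" "r < int n" using n(1) by (simp_all add: r_def)
    ultimately have "r = 0" using least[of "nat r"] by force
    then have "a = c powi q" using partial_character_graphD(7)[OF H ka] cq k by simp
    also have "\<dots> = d powi k" using d(1) by (simp add: k \<open>r = 0\<close> power_int_power mult.commute flip: d(1))
    finally show "a = d powi k" .
  qed
qed

text \<open>
  The multiplicative group of an algebraically closed field is divisible, hence injective.
\<close>

lemma partial_character_graph_extends:
  fixes H :: "(('r::comm_ring_1 ^ 'n) \<times> 'a::{alg_closed_field, field_char_0}) set"
  assumes "partial_character_graph H"
  obtains \<psi> where "character \<psi>" "\<And>f a. (f, a) \<in> H \<Longrightarrow> \<psi> f = a"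
proof -
  let ?\<A> = "{M. partial_character_graph M \<and> H \<subseteq> M}"
  have "\<exists>M\<in>?\<A>. \<forall>X\<in>?\<A>. M \<subseteq> X \<longrightarrow> X = M"
  proof (rule subset_Zorn_nonempty)
    show "?\<A> \<noteq> {}" using assms by auto
    fix \<C> assume ne: "\<C> \<noteq> {}" and ch: "subset.chain ?\<A> \<C>"
    have C: "\<And>M. M \<in> \<C> \<Longrightarrow> partial_character_graph M" "\<And>M. M \<in> \<C> \<Longrightarrow> H \<subseteq> M"
      using ch by (auto simp: subset_chain_def)
    have "(f - g, a / b) \<in> \<Union>\<C>" if "(f, a) \<in> \<Union>\<C>" "(g, b) \<in> \<Union>\<C>" for f a g b
    proof -
      from that obtain M N where M: "M \<in> \<C>" "N \<in> \<C>" "(f, a) \<in> M" "(g, b) \<in> N" by blast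
      then have "M \<subseteq> N \<or> N \<subseteq> M" using ch by (auto simp: subset_chain_def)
      then show ?thesis
        using M partial_character_graphD(2)[OF C(1)[OF M(1)]] partial_character_graphD(2)[OF C(1)[OF M(2)]]
        by blast
    qed
    moreover have "(0, 1) \<in> \<Union>\<C>" "\<And>f a. (f, a) \<in> \<Union>\<C> \<Longrightarrow> a \<noteq> 0" "\<And>a. (0, a) \<in> \<Union>\<C> \<Longrightarrow> a = 1"
      using partial_character_graphD[OF C(1)] ne by blast+
    ultimately show "\<Union>\<C> \<in> ?\<A>"
      using C(2) ne unfolding partial_character_graph_def by blast
  qed
  then obtain M where M: "partial_character_graph M" "H \<subseteq> M"
    and max: "\<And>X. partial_character_graph X \<Longrightarrow> M \<subseteq> X \<Longrightarrow> X = M"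
    by (smt (verit) mem_Collect_eq order_trans)
  have total: "\<exists>a. (g, a) \<in> M" for g
  proof (rule ccontr)
    assume "\<nexists>a. (g, a) \<in> M"
    then have g: "g \<notin> Domain M" by auto
    obtain d where d: "d \<noteq> 0" "d \<noteq> 1" "\<And>k a. (of_int k *s g, a) \<in> M \<Longrightarrow> a = d powi k"
      using partial_character_graph_new_value[OF M(1) g] by metis
    obtain X where "partial_character_graph X" "M \<subseteq> X" "(g, d) \<in> X"
      by (rule partial_character_graph_adjoin[OF M(1) d(1,3)])
    with max[of X] g show False by auto
  qed
  define \<psi> where "\<psi> f = (THE a. (f, a) \<in> M)" for f
  have psi_eq: "\<psi> f = a" if "(f, a) \<in> M" for f a
    unfolding \<psi>_def using that partial_character_graphD(7)[OF M(1)] by blast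
  have "character \<psi>"
    unfolding character_on_def
  proof (intro conjI ballI)
    fix f g
    obtain a b where ab: "(f, a) \<in> M" "(g, b) \<in> M" using total by blast
    then show "\<psi> f \<noteq> 0" "\<psi> (f + g) = \<psi> f * \<psi> g"
      using psi_eq partial_character_graphD(3,6)[OF M(1)] by metis+
  qed
  then show thesis using that psi_eq M(2) by blast
qed

lemma partial_character_graph_of_character:
  assumes "add_subgroup S" "character_on S \<rho>"
  shows "partial_character_graph ((\<lambda>f. (f, \<rho> f)) ` S)"
  using add_subgroupD[OF assms(1)] character_on_0[OF assms(2)] character_on_diff[OF assms(2,1)] assms(2)
  by (auto simp: partial_character_graph_def character_on_def)

lemma character_extends:
  fixes \<rho> :: "'r::comm_ring_1 ^ 'n \<Rightarrow> 'a::{alg_closed_field, field_char_0}"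
  assumes "add_subgroup S" "character_on S \<rho>"
  obtains \<psi> where "character \<psi>" "\<And>f. f \<in> S \<Longrightarrow> \<psi> f = \<rho> f"
proof -
  obtain \<psi> where "character \<psi>" "\<And>f a. (f, a) \<in> (\<lambda>f. (f, \<rho> f)) ` S \<Longrightarrow> \<psi> f = a"
    using partial_character_graph_extends[OF partial_character_graph_of_character[OF assms]] by metis
  then show thesis using that by blast
qed

lemma characters_separate:
  fixes S :: "('r::comm_ring_1 ^ 'n) set"
  assumes S: "add_subgroup S" and "g \<notin> S"
  obtains \<psi> :: "'r ^ 'n \<Rightarrow> 'a::{alg_closed_field, field_char_0}"
  where "character \<psi>" "\<And>f. f \<in> S \<Longrightarrow> \<psi> f = 1" "\<psi> g \<noteq> 1"
proof -
  let ?H = "(\<lambda>f. (f, 1::'a)) ` S"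
  have H: "partial_character_graph ?H"
    by (rule partial_character_graph_of_character[OF S]) (simp add: character_on_def)
  have "g \<notin> Domain ?H" using assms by auto
  then obtain d where d: "d \<noteq> 0" "d \<noteq> 1" "\<And>k a. (of_int k *s g, a) \<in> ?H \<Longrightarrow> a = d powi k"
    using partial_character_graph_new_value[OF H] by metis
  obtain X where X: "partial_character_graph X" "?H \<subseteq> X" "(g, d) \<in> X"
    by (rule partial_character_graph_adjoin[OF H d(1,3)])
  obtain \<psi> where "character \<psi>" "\<And>f a. (f, a) \<in> X \<Longrightarrow> \<psi> f = a"
    using partial_character_graph_extends[OF X(1)] by blast
  with X(2,3) d(2) show thesis by (intro that[of \<psi>]) auto
qed

section \<open>Torsion-free quotients are orderable\<close>

text \<open>
  \<open>P\<close> is the preimage of the nonnegative cone of a total group order on the torsion-free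
  quotient by \<open>T\<close>. It is a maximal set that is closed under addition and meets its negative
  only in \<open>T\<close>: if neither \<open>f\<close> nor \<open>- f\<close> can be adjoined, then positive multiples of both
  \<open>- f\<close> and \<open>f\<close> lie in \<open>P\<close>, so a common multiple of \<open>f\<close> lies in \<open>T\<close>, and \<open>f\<close> does too.
\<close>

lemma torsion_free_quotient_order:
  fixes T :: "('r::comm_ring_1 ^ 'n) set"
  assumes T: "add_subgroup T"
    and pure: "\<And>m f. m > 0 \<Longrightarrow> of_nat m *s f \<in> T \<Longrightarrow> f \<in> T"
  obtains P where "T \<subseteq> P" "\<And>f g. f \<in> P \<Longrightarrow> g \<in> P \<Longrightarrow> f + g \<in> P"
    "\<And>f. f \<in> P \<Longrightarrow> - f \<in> P \<Longrightarrow> f \<in> T" "\<And>f. f \<in> P \<or> - f \<in> P"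
proof -
  define cone where "cone P \<longleftrightarrow> T \<subseteq> P \<and> (\<forall>f\<in>P. \<forall>g\<in>P. f + g \<in> P) \<and> (\<forall>f\<in>P. - f \<in> P \<longrightarrow> f \<in> T)" for P
  have scale: "of_nat n *s f \<in> P" if "cone P" "f \<in> P" for n f P
  proof (induction n)
    case 0
    then show ?case using that add_subgroupD(1)[OF T] by (auto simp: cone_def)
  next
    case (Suc n)
    then show ?case using that by (simp add: cone_def vec_module.scale_left_distrib)
  qed
  have "\<exists>M\<in>Collect cone. \<forall>X\<in>Collect cone. M \<subseteq> X \<longrightarrow> X = M"
  proof (rule subset_Zorn_nonempty)
    have "cone T" using add_subgroupD[OF T] by (auto simp: cone_def)
    then show "Collect cone \<noteq> {}" by blast
    fix \<C> assume ne: "\<C> \<noteq> {}" and ch: "subset.chain (Collect cone) \<C>"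
    have C: "\<And>M. M \<in> \<C> \<Longrightarrow> cone M" and lin: "\<And>M N. M \<in> \<C> \<Longrightarrow> N \<in> \<C> \<Longrightarrow> M \<subseteq> N \<or> N \<subseteq> M"
      using ch by (auto simp: subset_chain_def)
    have "\<exists>Q\<in>\<C>. f \<in> Q \<and> g \<in> Q" if "f \<in> \<Union>\<C>" "g \<in> \<Union>\<C>" for f g
      using that lin by blast
    then have "f + g \<in> \<Union>\<C>" "- f \<in> \<Union>\<C> \<longrightarrow> f \<in> T" if "f \<in> \<Union>\<C>" "g \<in> \<Union>\<C>" for f g
      using that C unfolding cone_def by (metis UnionI)+
    moreover have "T \<subseteq> \<Union>\<C>" using ne C unfolding cone_def by blast
    ultimately have "cone (\<Union>\<C>)" unfolding cone_def by blast
    then show "\<Union>\<C> \<in> Collect cone" by simp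
  qed
  then obtain P where P: "cone P" and max: "\<And>X. cone X \<Longrightarrow> P \<subseteq> X \<Longrightarrow> X = P" by blast
  \<comment> \<open>If \<open>g\<close> cannot be adjoined to the maximal cone, a positive multiple of \<open>- g\<close> lies in it.\<close>
  have neg: "\<exists>n>0. - (of_nat n *s g) \<in> P" if g: "g \<notin> P" for g
  proof -
    define X where "X = {f + of_nat n *s g | f n. f \<in> P}"
    have PX: "P \<subseteq> X" unfolding X_def by (force intro: exI[of _ 0])
    have gX: "g \<in> X" unfolding X_def
      using P add_subgroupD(1)[OF T] by (intro CollectI exI[of _ 0] exI[of _ 1]) (auto simp: cone_def)
    have "\<not> cone X" using max[OF _ PX] gX g by blast
    moreover have "T \<subseteq> X" using PX P by (auto simp: cone_def)
    moreover have "f + h \<in> X" if "f \<in> X" "h \<in> X" for f h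
    proof -
      obtain f' n where "f = f' + of_nat n *s g" "f' \<in> P" using \<open>f \<in> X\<close> unfolding X_def by blast
      moreover obtain h' m where "h = h' + of_nat m *s g" "h' \<in> P" using \<open>h \<in> X\<close> unfolding X_def by blast
      moreover from calculation have "f' + h' \<in> P" using P by (auto simp: cone_def)
      moreover have "f + h = (f' + h') + of_nat (n + m) *s g"
        using calculation by (simp add: vec_module.scale_left_distrib)
      ultimately show ?thesis unfolding X_def by blast
    qed
    ultimately obtain f where f: "f \<in> X" "- f \<in> X" "f \<notin> T" unfolding cone_def by blast
    obtain f' n where "f = f' + of_nat n *s g" "f' \<in> P" using f(1) unfolding X_def by blast
    moreover obtain h' m where "- f = h' + of_nat m *s g" "h' \<in> P" using f(2) unfolding X_def by blast
    ultimately have *: "f = f' + of_nat n *s g" "f' \<in> P" "- f = h' + of_nat m *s g" "h' \<in> P" .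
    have "f + (- f) = (f' + of_nat n *s g) + (h' + of_nat m *s g)"
      unfolding *(3) by (simp only: *(1))
    then have "(f' + h') + of_nat (n + m) *s g = 0"
      by (simp add: vec_module.scale_left_distrib algebra_simps)
    then have eq: "f' + h' = - (of_nat (n + m) *s g)" by (simp only: eq_neg_iff_add_eq_0)
    have "n + m > 0"
    proof (rule ccontr)
      assume "\<not> n + m > 0"
      then have "f = f'" "- f = h'" using * by auto
      then show False using * f P by (auto simp: cone_def)
    qed
    moreover have "f' + h' \<in> P" using * P by (auto simp: cone_def)
    ultimately show ?thesis using eq by metis
  qed
  have "f \<in> P \<or> - f \<in> P" for f
  proof (rule ccontr)
    assume a: "\<not> (f \<in> P \<or> - f \<in> P)"
    obtain n where n: "n > 0" "- (of_nat n *s f) \<in> P" using neg[of f] a by blast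
    obtain m where m: "m > 0" "- (of_nat m *s (- f)) \<in> P" using neg[of "- f"] a by blast
    have "of_nat m *s (- (of_nat n *s f)) \<in> P" "of_nat n *s (- (of_nat m *s (- f))) \<in> P"
      using scale[OF P n(2)] scale[OF P m(2)] by auto
    then have "of_nat (m * n) *s f \<in> P" "- (of_nat (m * n) *s f) \<in> P"
      by (simp_all add: mult.commute)
    then have "of_nat (m * n) *s f \<in> T" using P by (auto simp: cone_def)
    then have "f \<in> T" using pure[of "m * n"] n m by simp
    then show False using a P by (auto simp: cone_def)
  qed
  then show thesis using P by (intro that[of P]) (auto simp: cone_def)
qed

section \<open>Twisted group algebras\<close>

text \<open>
  For a character \<open>w\<close> this is the evaluation of the group algebra element \<open>p\<close> at the point \<open>w\<close>
  of the torus; for an arbitrary \<open>w\<close> it is only the linear functional with these values on the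
  monomials.
\<close>

definition pairing :: "('g \<Rightarrow> 'a::comm_ring_1) \<Rightarrow> ('g \<Rightarrow>\<^sub>0 'a) \<Rightarrow> 'a" where
  "pairing w p = (\<Sum>f\<in>Poly_Mapping.keys p. Poly_Mapping.lookup p f * w f)"

lemma pairing_superset:
  assumes "finite A" "Poly_Mapping.keys p \<subseteq> A"
  shows "pairing w p = (\<Sum>f\<in>A. Poly_Mapping.lookup p f * w f)"
  unfolding pairing_def using assms by (intro sum.mono_neutral_left) (auto simp: in_keys_iff)

lemma pairing_0 [simp]: "pairing w 0 = 0"
  by (simp add: pairing_def)

lemma pairing_add: "pairing w (p + q) = pairing w p + pairing w q"
proof -
  let ?A = "Poly_Mapping.keys p \<union> Poly_Mapping.keys q"
  have "pairing w (p + q) = (\<Sum>f\<in>?A. Poly_Mapping.lookup (p + q) f * w f)"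
    by (rule pairing_superset) (auto simp: Poly_Mapping.keys_add)
  also have "\<dots> = pairing w p + pairing w q"
    by (simp add: lookup_add distrib_right sum.distrib pairing_superset[of ?A])
  finally show ?thesis .
qed

lemma pairing_sum: "pairing w (\<Sum>x\<in>A. p x) = (\<Sum>x\<in>A. pairing w (p x))"
  by (induction A rule: infinite_finite_induct) (simp_all add: pairing_add)

lemma pairing_single [simp]: "pairing w (Poly_Mapping.single f a) = a * w f"
  by (cases "a = 0") (simp_all add: pairing_def)

lemma pairing_fun_diff: "pairing (\<lambda>f. v f - w f) p = pairing v p - pairing w p"
  by (simp add: pairing_def right_diff_distrib sum_subtractf)

lemma pairing_fun_scale: "pairing (\<lambda>f. w f * c) p = pairing w p * c"
  by (simp add: pairing_def sum_distrib_right mult.assoc)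

lemma sum_of_monomials: "(\<Sum>f\<in>Poly_Mapping.keys p. Poly_Mapping.single f (Poly_Mapping.lookup p f)) = p"
  by (rule poly_mapping_eqI)
    (simp add: lookup_sum lookup_single when_def in_keys_iff sum.delta)

lemma pairing_mult:
  fixes p q :: "'g::monoid_add \<Rightarrow>\<^sub>0 'a::comm_ring_1"
  shows "pairing w (p * q) = pairing (\<lambda>f. pairing (\<lambda>g. w (f + g)) q) p"
proof -
  let ?m = "\<lambda>p f. Poly_Mapping.single f (Poly_Mapping.lookup p f)"
  have "p * q = (\<Sum>f\<in>Poly_Mapping.keys p. ?m p f) * (\<Sum>g\<in>Poly_Mapping.keys q. ?m q g)"
    by (simp only: sum_of_monomials)
  also have "\<dots> = (\<Sum>f\<in>Poly_Mapping.keys p. \<Sum>g\<in>Poly_Mapping.keys q.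
      Poly_Mapping.single (f + g) (Poly_Mapping.lookup p f * Poly_Mapping.lookup q g))"
    by (simp only: sum_product mult_single)
  finally show ?thesis
    by (simp only: pairing_sum pairing_single pairing_def[of _ p] pairing_def[of _ q] sum_distrib_left mult.assoc)
qed

definition periodic :: "'g::ab_group_add set \<Rightarrow> ('g \<Rightarrow> 'a) \<Rightarrow> bool" where
  "periodic T \<phi> \<longleftrightarrow> (\<forall>f t. t \<in> T \<longrightarrow> \<phi> (f + t) = \<phi> f)"

text \<open>
  This is the kernel of the map from the group algebra of \<open>G\<close> to that of \<open>G / T\<close> that sends the
  monomial with exponent \<open>f\<close> to \<open>\<psi> f\<close> times the class of \<open>f\<close>, that is, the ideal of the
  binomials that set the monomial of \<open>t \<in> T\<close> equal to \<open>\<psi> t\<close>. Testing against \<open>T\<close>-periodic functions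
  avoids both the quotient group and the choice of coset representatives.
\<close>

definition twisted_kernel :: "'g::ab_group_add set \<Rightarrow> ('g \<Rightarrow> 'a::field) \<Rightarrow> ('g \<Rightarrow>\<^sub>0 'a) set" where
  "twisted_kernel T \<psi> = {p. \<forall>\<phi>. periodic T \<phi> \<longrightarrow> pairing (\<lambda>f. \<psi> f * \<phi> f) p = 0}"

text \<open>
  The coefficient at the class of \<open>g\<close> of the image of \<open>p\<close> in the group algebra of the quotient.
\<close>

definition coset_sum :: "'g::ab_group_add set \<Rightarrow> ('g \<Rightarrow> 'a::field) \<Rightarrow> ('g \<Rightarrow>\<^sub>0 'a) \<Rightarrow> 'g \<Rightarrow> 'a" where
  "coset_sum T \<psi> p g = pairing (\<lambda>f. \<psi> f * (if f - g \<in> T then 1 else 0)) p"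

lemma twisted_kernelD:
  "p \<in> twisted_kernel T \<psi> \<Longrightarrow> periodic T \<phi> \<Longrightarrow> pairing (\<lambda>f. \<psi> f * \<phi> f) p = 0"
  by (simp add: twisted_kernel_def)

lemma subspace_twisted_kernel:
  fixes \<psi> :: "'g::ab_group_add \<Rightarrow> 'a::field"
  assumes "character \<psi>"
  shows "ring_module.subspace (twisted_kernel T \<psi>)"
proof (rule ring_module.subspaceI)
  fix q p assume p: "p \<in> twisted_kernel T \<psi>"
  show "q * p \<in> twisted_kernel T \<psi>"
    unfolding twisted_kernel_def
  proof (intro CollectI allI impI)
    fix \<phi> :: "'g \<Rightarrow> 'a" assume phi: "periodic T \<phi>"
    have "pairing (\<lambda>g. \<psi> (f + g) * \<phi> (f + g)) p = 0" for f
    proof -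
      have "periodic T (\<lambda>g. \<psi> f * \<phi> (f + g))" using phi by (simp add: periodic_def add.assoc[symmetric])
      from twisted_kernelD[OF p this] have "pairing (\<lambda>g. \<psi> g * (\<psi> f * \<phi> (f + g))) p = 0" .
      moreover have "\<psi> g * (\<psi> f * \<phi> (f + g)) = \<psi> (f + g) * \<phi> (f + g)" for g
        by (simp only: characterD(2)[OF assms] mult_ac)
      ultimately show ?thesis by (simp only:)
    qed
    then show "pairing (\<lambda>f. \<psi> f * \<phi> f) (q * p) = 0"
      by (simp add: pairing_mult) (simp add: pairing_def)
  qed
qed (auto simp: twisted_kernel_def pairing_add)

lemma periodic_indicator:
  assumes "add_subgroup T"
  shows "periodic T (\<lambda>f. if f - g \<in> T then c else d)"
proof -
  have "f + t - g \<in> T \<longleftrightarrow> f - g \<in> T" if "t \<in> T" for f t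
    using add_subgroupD(2)[OF assms, of "f + t - g" t] add_subgroupD(3)[OF assms, of "f - g" t] that
    by (auto simp: algebra_simps)
  then show ?thesis by (simp add: periodic_def)
qed

lemma periodic_eq: "periodic T \<phi> \<Longrightarrow> f - g \<in> T \<Longrightarrow> \<phi> f = \<phi> g"
  unfolding periodic_def by (drule spec[of _ g], drule spec[of _ "f - g"]) simp

lemma coset_sum_periodic:
  assumes "add_subgroup T" "f - g \<in> T"
  shows "coset_sum T \<psi> p f = coset_sum T \<psi> p g"
proof -
  have "h - f \<in> T \<longleftrightarrow> h - g \<in> T" for h
    using add_subgroupD(3)[OF assms(1), of "h - f" "f - g"] add_subgroupD(2)[OF assms(1), of "h - g" "f - g"] assms(2)
    by auto
  then show ?thesis by (simp add: coset_sum_def)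
qed

lemma sum_by_cosets:
  assumes T: "add_subgroup T"
    and zero: "\<And>g. g \<in> A \<Longrightarrow> (\<Sum>f | f \<in> A \<and> f - g \<in> T. F f) = 0" and "finite A"
  shows "(\<Sum>f\<in>A. F f) = (0::'b::comm_monoid_add)"
proof -
  define c where "c f = {h. h - f \<in> T}" for f
  have c: "c f = c g \<longleftrightarrow> f - g \<in> T" for f g
  proof
    assume "c f = c g"
    moreover have "f \<in> c f" using add_subgroupD(1)[OF T] by (simp add: c_def)
    ultimately show "f - g \<in> T" by (simp add: c_def)
  next
    assume fg: "f - g \<in> T"
    have "h - f \<in> T \<longleftrightarrow> h - g \<in> T" for h
      using add_subgroupD(3)[OF T, of "h - f" "f - g"] add_subgroupD(2)[OF T, of "h - g" "f - g"] fg
      by auto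
    then show "c f = c g" by (simp add: c_def)
  qed
  have "(\<Sum>f\<in>A. F f) = (\<Sum>C\<in>c ` A. \<Sum>f | f \<in> A \<and> c f = C. F f)"
    by (rule sum.image_gen[OF \<open>finite A\<close>])
  also have "\<dots> = 0" using zero by (intro sum.neutral) (auto simp: c)
  finally show ?thesis .
qed

lemma coset_sum_eq:
  "coset_sum T \<psi> p g = (\<Sum>f | f \<in> Poly_Mapping.keys p \<and> f - g \<in> T. Poly_Mapping.lookup p f * \<psi> f)"
proof -
  have "coset_sum T \<psi> p g =
      (\<Sum>f\<in>Poly_Mapping.keys p. if f - g \<in> T then Poly_Mapping.lookup p f * \<psi> f else 0)"
    unfolding coset_sum_def pairing_def by (intro sum.cong) auto
  then show ?thesis by (simp add: sum.If_cases Collect_conj_eq Int_commute)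
qed

lemma pairing_eq_0_by_cosets:
  assumes T: "add_subgroup T" and phi: "periodic T \<phi>"
    and zero: "\<And>g. coset_sum T \<psi> p g = 0 \<or> \<phi> g = 0"
  shows "pairing (\<lambda>f. \<psi> f * \<phi> f) p = 0"
  unfolding pairing_def
proof (rule sum_by_cosets[OF T])
  fix g
  have "(\<Sum>f | f \<in> Poly_Mapping.keys p \<and> f - g \<in> T. Poly_Mapping.lookup p f * (\<psi> f * \<phi> f))
      = (\<Sum>f | f \<in> Poly_Mapping.keys p \<and> f - g \<in> T. Poly_Mapping.lookup p f * \<psi> f * \<phi> g)"
    using periodic_eq[OF phi] by (intro sum.cong) auto
  also have "\<dots> = coset_sum T \<psi> p g * \<phi> g"
    by (simp add: coset_sum_eq sum_distrib_right)
  also have "\<dots> = 0" using zero[of g] by auto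
  finally show "(\<Sum>f | f \<in> Poly_Mapping.keys p \<and> f - g \<in> T. Poly_Mapping.lookup p f * (\<psi> f * \<phi> f)) = 0" .
qed simp

lemma twisted_kernel_iff_coset_sum:
  assumes "add_subgroup T"
  shows "p \<in> twisted_kernel T \<psi> \<longleftrightarrow> (\<forall>g. coset_sum T \<psi> p g = 0)"
proof
  assume "p \<in> twisted_kernel T \<psi>"
  from twisted_kernelD[OF this periodic_indicator[OF assms, of _ 1 0]]
  show "\<forall>g. coset_sum T \<psi> p g = 0" by (simp add: coset_sum_def)
next
  assume "\<forall>g. coset_sum T \<psi> p g = 0"
  then show "p \<in> twisted_kernel T \<psi>"
    unfolding twisted_kernel_def
    by (intro CollectI allI impI pairing_eq_0_by_cosets[OF assms]) auto
qed

text \<open>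
  The indicator function of \<open>T\<close> is the periodic function that tells a monomial with exponent
  outside \<open>T\<close> from a constant.
\<close>

lemma binomial_in_twisted_kernel_iff:
  fixes \<psi> :: "'g::ab_group_add \<Rightarrow> 'a::field"
  assumes T: "add_subgroup T" and psi: "character \<psi>" and "c \<noteq> 0"
  shows "Poly_Mapping.single f 1 - Poly_Mapping.single 0 c \<in> twisted_kernel T \<psi> \<longleftrightarrow> f \<in> T \<and> c = \<psi> f"
proof -
  have pair: "pairing w (Poly_Mapping.single f 1 - Poly_Mapping.single 0 c) = w f - c * w 0" for w :: "'g \<Rightarrow> 'a"
    by (simp only: diff_conv_add_uminus pairing_add single_uminus[symmetric] pairing_single) simp
  show ?thesis
  proof
    assume *: "Poly_Mapping.single f 1 - Poly_Mapping.single 0 c \<in> twisted_kernel T \<psi>"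
    from twisted_kernelD[OF this periodic_indicator[OF T, of 0 1 0]]
    show "f \<in> T \<and> c = \<psi> f"
      using \<open>c \<noteq> 0\<close> add_subgroupD(1)[OF T] by (auto simp: pair characterD[OF psi] split: if_splits)
  next
    assume "f \<in> T \<and> c = \<psi> f"
    then have f: "f - 0 \<in> T" and c: "c = \<psi> f" by auto
    show "Poly_Mapping.single f 1 - Poly_Mapping.single 0 c \<in> twisted_kernel T \<psi>"
      unfolding twisted_kernel_def
    proof (intro CollectI allI impI)
      fix \<phi> :: "'g \<Rightarrow> 'a" assume "periodic T \<phi>"
      then have "\<phi> f = \<phi> 0" using f by (rule periodic_eq)
      then show "pairing (\<lambda>f. \<psi> f * \<phi> f) (Poly_Mapping.single f 1 - Poly_Mapping.single 0 c) = 0"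
        unfolding pair by (simp add: characterD(3)[OF psi] c)
    qed
  qed
qed

text \<open>
  Modulo an ideal that contains the binomials of \<open>T\<close>, the part of \<open>p\<close> supported on a coset
  collapses to a single term, whose coefficient is the coset sum up to a unit. So the twisted
  kernel is generated by these binomials.
\<close>

lemma twisted_kernel_subset_ideal:
  fixes \<psi> :: "'g::ab_group_add \<Rightarrow> 'a::field"
  assumes T: "add_subgroup T" and psi: "character \<psi>" and J: "ring_module.subspace J"
    and gen: "\<And>t. t \<in> T \<Longrightarrow> Poly_Mapping.single t 1 - Poly_Mapping.single 0 (\<psi> t) \<in> J"
  shows "twisted_kernel T \<psi> \<subseteq> J"
proof
  fix p assume p: "p \<in> twisted_kernel T \<psi>"
  \<comment> \<open>Each coset is collapsed onto one exponent.\<close>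
  have collapse: "Poly_Mapping.single f a - Poly_Mapping.single g (a * \<psi> f / \<psi> g) \<in> J"
    if "f - g \<in> T" for f g and a :: 'a
  proof -
    have "Poly_Mapping.single g a * (Poly_Mapping.single (f - g) 1 - Poly_Mapping.single 0 (\<psi> (f - g))) \<in> J"
      using J gen[OF that] by (rule ring_module.subspace_scale)
    then show ?thesis by (simp add: right_diff_distrib mult_single characterD[OF psi])
  qed
  define rep where "rep f = (SOME g. g \<in> Poly_Mapping.keys p \<and> f - g \<in> T)" for f
  have rep: "rep f \<in> Poly_Mapping.keys p \<and> f - rep f \<in> T" if "f \<in> Poly_Mapping.keys p" for f
    unfolding rep_def by (rule someI[of _ f]) (use that add_subgroupD(1)[OF T] in auto)
  have rep_eq: "rep f = rep g" if "f - g \<in> T" for f g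
  proof -
    have "f - h \<in> T \<longleftrightarrow> g - h \<in> T" for h
      using add_subgroupD(3)[OF T, of "g - h" "f - g"] add_subgroupD(2)[OF T, of "f - h" "f - g"] that
      by (auto simp: algebra_simps)
    then show ?thesis by (simp add: rep_def)
  qed
  let ?m = "\<lambda>f. Poly_Mapping.single f (Poly_Mapping.lookup p f)"
  let ?r = "\<lambda>f. Poly_Mapping.single (rep f) (Poly_Mapping.lookup p f * \<psi> f / \<psi> (rep f))"
  have zero: "(\<Sum>f\<in>Poly_Mapping.keys p. ?r f) = 0"
  proof (rule sum_by_cosets[OF T])
    fix g assume "g \<in> Poly_Mapping.keys p"
    let ?C = "{f. f \<in> Poly_Mapping.keys p \<and> f - g \<in> T}"
    have "(\<Sum>f\<in>?C. ?r f) = (\<Sum>f\<in>?C. Poly_Mapping.single (rep g) (Poly_Mapping.lookup p f * \<psi> f / \<psi> (rep g)))"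
      using rep_eq by (intro sum.cong) auto
    also have "\<dots> = Poly_Mapping.single (rep g) (\<Sum>f\<in>?C. Poly_Mapping.lookup p f * \<psi> f / \<psi> (rep g))"
      by (rule poly_mapping_eqI) (simp add: lookup_sum lookup_single when_def)
    also have "(\<Sum>f\<in>?C. Poly_Mapping.lookup p f * \<psi> f / \<psi> (rep g)) = coset_sum T \<psi> p g / \<psi> (rep g)"
      by (simp add: coset_sum_eq sum_divide_distrib)
    also have "\<dots> = 0" using p by (simp add: twisted_kernel_iff_coset_sum[OF T])
    finally show "(\<Sum>f\<in>?C. ?r f) = 0" by simp
  qed simp
  have "(\<Sum>f\<in>Poly_Mapping.keys p. ?m f - ?r f) \<in> J"
    using rep by (intro ring_module.subspace_sum[OF J] collapse) blast
  then show "p \<in> J" by (simp add: sum_subtractf zero sum_of_monomials)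
qed

lemma finite_maximal_wrt_cone:
  fixes P :: "'g::ab_group_add set"
  assumes "finite A" "A \<noteq> {}" and add: "\<And>f g. f \<in> P \<Longrightarrow> g \<in> P \<Longrightarrow> f + g \<in> P"
    and tot: "\<And>f. f \<in> P \<or> - f \<in> P"
  shows "\<exists>m\<in>A. \<forall>a\<in>A. m - a \<in> P"
  using assms(1,2)
proof (induction A rule: finite_ne_induct)
  case (singleton x)
  then show ?case using tot[of 0] by simp
next
  case (insert x A)
  then obtain m where m: "m \<in> A" "\<And>a. a \<in> A \<Longrightarrow> m - a \<in> P" by blast
  have 0: "0 \<in> P" using tot[of 0] by simp
  show ?case
  proof (cases "m - x \<in> P")
    case True
    then show ?thesis using m by blast
  next
    case False
    then have xm: "x - m \<in> P" using tot[of "m - x"] by simp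
    have "x - a \<in> P" if "a \<in> A" for a using add[OF xm m(2)[OF that]] by simp
    then show ?thesis using 0 by auto
  qed
qed

lemma coset_sum_top:
  fixes P :: "'g::ab_group_add set" and p :: "'g \<Rightarrow>\<^sub>0 'a::field"
  assumes T: "add_subgroup T" and TP: "T \<subseteq> P"
    and add: "\<And>f g. f \<in> P \<Longrightarrow> g \<in> P \<Longrightarrow> f + g \<in> P" and tot: "\<And>f. f \<in> P \<or> - f \<in> P"
    and p: "p \<notin> twisted_kernel T \<psi>"
  obtains m where "coset_sum T \<psi> p m \<noteq> 0" "\<And>f. coset_sum T \<psi> p f \<noteq> 0 \<Longrightarrow> m - f \<in> P"
proof -
  let ?A = "{f \<in> Poly_Mapping.keys p. coset_sum T \<psi> p f \<noteq> 0}"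
  have key: "\<exists>g\<in>?A. g - f \<in> T" if "coset_sum T \<psi> p f \<noteq> 0" for f
  proof -
    obtain g where "g \<in> Poly_Mapping.keys p" "g - f \<in> T"
      using \<open>coset_sum T \<psi> p f \<noteq> 0\<close> unfolding coset_sum_eq by (metis (mono_tags, lifting) mem_Collect_eq sum.neutral ex_in_conv)
    with that coset_sum_periodic[OF T \<open>g - f \<in> T\<close>, of \<psi> p] show ?thesis by auto
  qed
  have "?A \<noteq> {}" using p key unfolding twisted_kernel_iff_coset_sum[OF T] by blast
  then obtain m where m: "m \<in> ?A" "\<And>a. a \<in> ?A \<Longrightarrow> m - a \<in> P"
    using finite_maximal_wrt_cone[of ?A P, OF _ _ add tot] by auto
  show thesis
  proof (rule that)
    show "coset_sum T \<psi> p m \<noteq> 0" using m by simp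
    fix f assume "coset_sum T \<psi> p f \<noteq> 0"
    then obtain g where "g \<in> ?A" "g - f \<in> T" using key by blast
    then show "m - f \<in> P" using add[OF m(2), of g "g - f"] TP by auto
  qed
qed

text \<open>
  The group algebra of a torsion-free abelian group is a domain: in a total order of the quotient
  the leading coset of a product is the sum of the leading cosets of the factors, and its
  coefficient is the product of their coefficients.
\<close>

lemma twisted_kernel_prime:
  fixes T :: "('r::comm_ring_1 ^ 'n) set" and \<psi> :: "'r ^ 'n \<Rightarrow> 'a::field"
  assumes T: "add_subgroup T"
    and pure: "\<And>m f. m > 0 \<Longrightarrow> of_nat m *s f \<in> T \<Longrightarrow> f \<in> T"
    and psi: "character \<psi>" and pq: "p * q \<in> twisted_kernel T \<psi>"
  shows "p \<in> twisted_kernel T \<psi> \<or> q \<in> twisted_kernel T \<psi>"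
proof (rule ccontr)
  assume "\<not> ?thesis"
  then have p: "p \<notin> twisted_kernel T \<psi>" and q: "q \<notin> twisted_kernel T \<psi>" by auto
  obtain P where P: "T \<subseteq> P" "\<And>f g. f \<in> P \<Longrightarrow> g \<in> P \<Longrightarrow> f + g \<in> P"
    "\<And>f. f \<in> P \<Longrightarrow> - f \<in> P \<Longrightarrow> f \<in> T" "\<And>f. f \<in> P \<or> - f \<in> P"
    by (rule torsion_free_quotient_order[OF T]) (erule (1) pure, rule that)
  obtain a where a: "coset_sum T \<psi> p a \<noteq> 0" "\<And>f. coset_sum T \<psi> p f \<noteq> 0 \<Longrightarrow> a - f \<in> P"
    using coset_sum_top[OF T P(1,2,4) p] by metis
  obtain b where b: "coset_sum T \<psi> q b \<noteq> 0" "\<And>f. coset_sum T \<psi> q f \<noteq> 0 \<Longrightarrow> b - f \<in> P"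
    using coset_sum_top[OF T P(1,2,4) q] by metis
  \<comment> \<open>\<open>\<phi>\<close> turns the coset sum of \<open>p * q\<close> at the leading coset into a pairing with \<open>p\<close>.\<close>
  define \<phi> where "\<phi> f = coset_sum T \<psi> q (a + b - f)" for f
  have phi: "periodic T \<phi>"
    unfolding periodic_def \<phi>_def
    by (intro allI impI coset_sum_periodic[OF T]) (simp add: add_subgroupD(4)[OF T])
  have "pairing (\<lambda>f. \<psi> f * \<phi> f) p = coset_sum T \<psi> (p * q) (a + b)"
  proof -
    have "pairing (\<lambda>g. \<psi> (f + g) * (if f + g - (a + b) \<in> T then 1 else 0)) q = \<psi> f * \<phi> f" for f
    proof -
      have eq: "\<psi> (f + g) * (if f + g - (a + b) \<in> T then 1 else 0)
          = (\<psi> g * (if g - (a + b - f) \<in> T then 1 else 0)) * \<psi> f" for g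
      proof -
        have "f + g - (a + b) = g - (a + b - f)" by simp
        then show ?thesis by (simp only: characterD(2)[OF psi] mult_ac)
      qed
      show ?thesis
        unfolding eq pairing_fun_scale \<phi>_def coset_sum_def by (rule mult.commute)
    qed
    then show ?thesis by (simp only: coset_sum_def pairing_mult)
  qed
  also have "\<dots> = 0" using pq by (simp add: twisted_kernel_iff_coset_sum[OF T])
  finally have total: "pairing (\<lambda>f. \<psi> f * \<phi> f) p = 0" .
  \<comment> \<open>Only the coset of \<open>a\<close> contributes to this sum, so subtracting it from \<open>\<phi>\<close> leaves nothing.\<close>
  define \<phi>' where "\<phi>' f = \<phi> f - (if f - a \<in> T then 1 else 0) * \<phi> a" for f
  have "pairing (\<lambda>f. \<psi> f * \<phi>' f) p = 0"
  proof (rule pairing_eq_0_by_cosets[OF T])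
    show "periodic T \<phi>'"
      using phi periodic_indicator[OF T, of a "1::'a" 0] unfolding periodic_def \<phi>'_def by simp
    fix f
    show "coset_sum T \<psi> p f = 0 \<or> \<phi>' f = 0"
    proof (cases "f - a \<in> T")
      case True
      then show ?thesis using periodic_eq[OF phi True] by (simp add: \<phi>'_def)
    next
      case False
      have "coset_sum T \<psi> p f = 0 \<or> \<phi> f = 0"
      proof (rule ccontr)
        assume "\<not> ?thesis"
        then have "a - f \<in> P" "b - (a + b - f) \<in> P" using a(2)[of f] b(2)[of "a + b - f"] by (auto simp: \<phi>_def)
        then show False using P(3)[of "f - a"] False by simp
      qed
      then show ?thesis using False by (simp add: \<phi>'_def)
    qed
  qed
  then have "pairing (\<lambda>f. \<psi> f * \<phi> f - (\<psi> f * (if f - a \<in> T then 1 else 0)) * \<phi> a) p = 0"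
    by (simp only: \<phi>'_def right_diff_distrib mult.assoc)
  then have "coset_sum T \<psi> p a * \<phi> a = 0"
    using total by (simp only: pairing_fun_diff pairing_fun_scale coset_sum_def) simp
  then show False using a(1) b(1) by (simp add: \<phi>_def)
qed

text \<open>
  The twisted kernel of \<open>S\<close> is cut out by the points of the torus that extend \<open>\<psi>\<close> on \<open>S\<close>.
  Characters that are trivial on \<open>S\<close> separate cosets, so, as in Lagrange interpolation, a product
  of factors \<open>\<theta> h - \<theta> f\<close> with such \<open>\<theta>\<close> vanishes at all \<open>f\<close> in the support of \<open>p\<close>
  outside a given coset and is a nonzero constant on that coset. Expanded, it is a linear
  combination of characters trivial on \<open>S\<close>, so the assumption makes the coset sum vanish.
\<close>

lemma twisted_kernel_from_characters:
  fixes S :: "('r::comm_ring_1 ^ 'n) set" and \<psi> :: "'r ^ 'n \<Rightarrow> 'a::{alg_closed_field, field_char_0}"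
  assumes S: "add_subgroup S" and psi: "character \<psi>"
    and all: "\<And>\<eta>. character \<eta> \<Longrightarrow> (\<And>f. f \<in> S \<Longrightarrow> \<eta> f = \<psi> f) \<Longrightarrow> pairing \<eta> p = 0"
  shows "p \<in> twisted_kernel S \<psi>"
  unfolding twisted_kernel_iff_coset_sum[OF S]
proof
  fix g
  define X where "X = {\<theta> :: 'r ^ 'n \<Rightarrow> 'a. character \<theta> \<and> (\<forall>f\<in>S. \<theta> f = 1)}"
  have Xper: "periodic S \<theta>" if "\<theta> \<in> X" for \<theta>
    using that by (simp add: X_def periodic_def character_on_def)
  define B where "B = {f \<in> Poly_Mapping.keys p. f - g \<notin> S}"
  have "\<exists>\<theta>\<in>X. \<theta> f \<noteq> \<theta> g" if "f \<in> B" for f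
  proof -
    have "f - g \<notin> S" using that by (simp add: B_def)
    then obtain \<theta> :: "'r ^ 'n \<Rightarrow> 'a" where *: "character \<theta>" "\<And>f. f \<in> S \<Longrightarrow> \<theta> f = 1" "\<theta> (f - g) \<noteq> 1"
      using characters_separate[OF S] by metis
    then have "\<theta> f \<noteq> \<theta> g" using characterD[OF *(1)] by auto
    then show ?thesis using * by (auto simp: X_def)
  qed
  then obtain \<theta> where theta: "\<And>f. f \<in> B \<Longrightarrow> \<theta> f \<in> X" "\<And>f. f \<in> B \<Longrightarrow> \<theta> f f \<noteq> \<theta> f g" by metis
  \<comment> \<open>The extra factor \<open>\<eta>\<close> absorbs \<open>\<theta> b\<close> when the product is expanded.\<close>
  have vanish: "\<eta> \<in> X \<Longrightarrow> pairing (\<lambda>h. \<psi> h * \<eta> h * (\<Prod>f\<in>A. \<theta> f h - \<theta> f f)) p = 0"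
    if "finite A" "A \<subseteq> B" for A \<eta>
    using that
  proof (induction A arbitrary: \<eta> rule: finite_induct)
    case empty
    have "character (\<lambda>h. \<psi> h * \<eta> h)" "\<And>f. f \<in> S \<Longrightarrow> \<psi> f * \<eta> f = \<psi> f"
      using empty psi by (auto simp: X_def character_on_def)
    from all[OF this] show ?case by simp
  next
    case (insert b A)
    have b: "\<theta> b \<in> X" using insert.prems theta by auto
    then have "(\<lambda>h. \<eta> h * \<theta> b h) \<in> X"
      using insert.prems by (auto simp: X_def character_on_def)
    then have "pairing (\<lambda>h. \<psi> h * (\<eta> h * \<theta> b h) * (\<Prod>f\<in>A. \<theta> f h - \<theta> f f)) p = 0"
      "pairing (\<lambda>h. \<psi> h * \<eta> h * (\<Prod>f\<in>A. \<theta> f h - \<theta> f f)) p = 0"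
      using insert.IH insert.prems by blast+
    then have diff: "pairing (\<lambda>h. \<psi> h * (\<eta> h * \<theta> b h) * (\<Prod>f\<in>A. \<theta> f h - \<theta> f f)
        - (\<psi> h * \<eta> h * (\<Prod>f\<in>A. \<theta> f h - \<theta> f f)) * \<theta> b b) p = 0"
      by (simp only: pairing_fun_diff pairing_fun_scale) simp
    have expand: "x * (y * z) * q - (x * y * q) * w = x * y * ((z - w) * q)" for x y z w q :: 'a
      by (simp add: algebra_simps)
    have "\<psi> h * (\<eta> h * \<theta> b h) * (\<Prod>f\<in>A. \<theta> f h - \<theta> f f)
        - (\<psi> h * \<eta> h * (\<Prod>f\<in>A. \<theta> f h - \<theta> f f)) * \<theta> b b
      = \<psi> h * \<eta> h * (\<Prod>f\<in>insert b A. \<theta> f h - \<theta> f f)" for h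
      unfolding prod.insert[OF insert.hyps] by (rule expand)
    then show ?case using diff by (simp only:)
  qed
  define c where "c = (\<Prod>f\<in>B. \<theta> f g - \<theta> f f)"
  have fB: "finite B" by (simp add: B_def)
  have "\<theta> f g - \<theta> f f \<noteq> 0" if "f \<in> B" for f using theta(2)[OF that] by simp
  then have "c \<noteq> 0" using fB by (simp add: c_def)
  have one: "(\<lambda>_. 1) \<in> X" by (simp add: X_def character_on_def)
  have "coset_sum S \<psi> p g * c = pairing (\<lambda>h. \<psi> h * (if h - g \<in> S then 1 else 0) * c) p"
    by (simp only: coset_sum_def pairing_fun_scale)
  also have "\<dots> = pairing (\<lambda>h. \<psi> h * 1 * (\<Prod>f\<in>B. \<theta> f h - \<theta> f f)) p"
    unfolding pairing_def
  proof (rule sum.cong[OF refl])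
    fix h assume h: "h \<in> Poly_Mapping.keys p"
    have "\<psi> h * (if h - g \<in> S then 1 else 0) * c = \<psi> h * 1 * (\<Prod>f\<in>B. \<theta> f h - \<theta> f f)"
    proof (cases "h - g \<in> S")
      case True
      then have "\<theta> f h = \<theta> f g" if "f \<in> B" for f using periodic_eq[OF Xper[OF theta(1)[OF that]]] by blast
      then show ?thesis using True by (simp add: c_def)
    next
      case False
      then have "h \<in> B" using h by (simp add: B_def)
      then have "(\<Prod>f\<in>B. \<theta> f h - \<theta> f f) = 0" using fB by (intro prod_zero) auto
      then show ?thesis using False by simp
    qed
    then show "Poly_Mapping.lookup p h * (\<psi> h * (if h - g \<in> S then 1 else 0) * c)
        = Poly_Mapping.lookup p h * (\<psi> h * 1 * (\<Prod>f\<in>B. \<theta> f h - \<theta> f f))"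
      by (simp only:)
  qed
  also have "\<dots> = 0" using vanish[OF fB subset_refl one] by simp
  finally show "coset_sum S \<psi> p g = 0" using \<open>c \<noteq> 0\<close> by simp
qed

section \<open>The difference structure\<close>

lemma difference_fieldD:
  assumes "difference_field \<sigma>"
  shows "\<sigma> (a + b) = \<sigma> a + \<sigma> b" "\<sigma> (a * b) = \<sigma> a * \<sigma> b" "\<sigma> 1 = 1" "\<sigma> a = 0 \<longleftrightarrow> a = 0"
    "\<sigma> 0 = 0" "\<sigma> (- a) = - \<sigma> a" "\<sigma> (a ^ n) = \<sigma> a ^ n" "\<sigma> (\<Sum>x\<in>A. h x) = (\<Sum>x\<in>A. \<sigma> (h x))"
proof -
  show add: "\<sigma> (a + b) = \<sigma> a + \<sigma> b" and mult: "\<sigma> (a * b) = \<sigma> a * \<sigma> b" and one: "\<sigma> 1 = 1"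
    and "\<sigma> a = 0 \<longleftrightarrow> a = 0" and zero: "\<sigma> 0 = 0" for a b
    using assms by (auto simp: difference_field_def)
  show "\<sigma> (- a) = - \<sigma> a" using add[of a "- a"] zero by (simp add: eq_neg_iff_add_eq_0 add.commute)
  show "\<sigma> (a ^ n) = \<sigma> a ^ n" by (induction n) (simp_all add: one mult)
  show "\<sigma> (\<Sum>x\<in>A. h x) = (\<Sum>x\<in>A. \<sigma> (h x))"
    by (induction A rule: infinite_finite_induct) (simp_all add: zero add)
qed

lemma laurent_sigma_add:
  assumes "difference_field \<sigma>"
  shows "laurent_sigma \<sigma> (p + q) = laurent_sigma \<sigma> p + laurent_sigma \<sigma> q"
proof -
  let ?A = "Poly_Mapping.keys p \<union> Poly_Mapping.keys q"
  have ext: "laurent_sigma \<sigma> r = (\<Sum>f\<in>?A. lmonom (\<sigma> (Poly_Mapping.lookup r f)) (shift f))"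
    if "Poly_Mapping.keys r \<subseteq> ?A" for r
    unfolding laurent_sigma_def
    using that by (intro sum.mono_neutral_left) (auto simp: in_keys_iff difference_fieldD[OF assms])
  have "laurent_sigma \<sigma> (p + q) = (\<Sum>f\<in>?A. lmonom (\<sigma> (Poly_Mapping.lookup (p + q) f)) (shift f))"
    by (rule ext) (rule Poly_Mapping.keys_add)
  also have "\<dots> = laurent_sigma \<sigma> p + laurent_sigma \<sigma> q"
    by (simp add: ext lookup_add difference_fieldD(1)[OF assms] single_add sum.distrib)
  finally show ?thesis .
qed

lemma laurent_sigma_binomial:
  assumes "difference_field \<sigma>"
  shows "laurent_sigma \<sigma> (lmonom 1 f - lconst c) = lmonom 1 (shift f) - lconst (\<sigma> c)"
  by (simp only: diff_conv_add_uminus single_uminus[symmetric] laurent_sigma_add[OF assms]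
      laurent_sigma_lmonom[OF assms] difference_fieldD[OF assms] vec_module.scale_zero_right)

lemma pairing_laurent_sigma:
  "pairing w (laurent_sigma \<sigma> p) =
    (\<Sum>f\<in>Poly_Mapping.keys p. \<sigma> (Poly_Mapping.lookup p f) * w (shift f))"
  by (simp add: laurent_sigma_def pairing_sum)

text \<open>
  If \<open>\<psi>\<close> intertwines the shift with \<open>\<sigma>\<close> on \<open>T\<close>, then \<open>\<sigma>\<close> maps the binomials of \<open>T\<close> to
  binomials of \<open>T\<close>. In terms of functionals: a test function for \<open>\<sigma> p\<close> is pulled back along the
  shift and through the inverse of \<open>\<sigma>\<close> to a test function for \<open>p\<close>.
\<close>

lemma sigma_ideal_twisted_kernel:
  fixes \<psi> :: "int poly ^ 'n::finite \<Rightarrow> 'a::field"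
  assumes df: "difference_field \<sigma>" and inv: "inversive \<sigma>" and psi: "character \<psi>"
    and T: "\<And>t. t \<in> T \<Longrightarrow> shift t \<in> T" "\<And>t. t \<in> T \<Longrightarrow> \<psi> (shift t) = \<sigma> (\<psi> t)"
  shows "sigma_ideal \<sigma> (twisted_kernel T \<psi>)"
  unfolding sigma_ideal_def
proof (intro conjI ballI)
  fix p assume p: "p \<in> twisted_kernel T \<psi>"
  show "laurent_sigma \<sigma> p \<in> twisted_kernel T \<psi>"
    unfolding twisted_kernel_def
  proof (intro CollectI allI impI)
    fix \<phi> :: "int poly ^ 'n \<Rightarrow> 'a" assume phi: "periodic T \<phi>"
    define \<phi>' where "\<phi>' f = inv \<sigma> (\<psi> (shift f) * \<phi> (shift f) / \<sigma> (\<psi> f))" for f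
    have surj: "\<sigma> (inv \<sigma> a) = a" for a
      using inv by (simp add: inversive_def bij_is_surj surj_f_inv_f)
    have nz: "\<sigma> (\<psi> f) \<noteq> 0" for f using difference_fieldD(4)[OF df] characterD(1)[OF psi] by simp
    have "periodic T \<phi>'"
      unfolding periodic_def
    proof (intro allI impI)
      fix f t assume t: "t \<in> T"
      have "\<phi> (shift (f + t)) = \<phi> (shift f)"
        using phi T(1)[OF t] by (simp add: periodic_def vec_module.scale_right_distrib)
      moreover have "\<psi> (shift (f + t)) = \<psi> (shift f) * \<sigma> (\<psi> t)"
        using T(2)[OF t] by (simp add: vec_module.scale_right_distrib characterD(2)[OF psi])
      moreover have "\<sigma> (\<psi> (f + t)) = \<sigma> (\<psi> f) * \<sigma> (\<psi> t)"
        by (simp add: characterD(2)[OF psi] difference_fieldD(2)[OF df])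
      ultimately show "\<phi>' (f + t) = \<phi>' f" using nz[of t] by (simp add: \<phi>'_def)
    qed
    from twisted_kernelD[OF p this] have "\<sigma> (pairing (\<lambda>f. \<psi> f * \<phi>' f) p) = 0"
      by (simp add: difference_fieldD(5)[OF df])
    also have "\<sigma> (pairing (\<lambda>f. \<psi> f * \<phi>' f) p)
        = (\<Sum>f\<in>Poly_Mapping.keys p. \<sigma> (Poly_Mapping.lookup p f) * (\<psi> (shift f) * \<phi> (shift f)))"
      unfolding pairing_def difference_fieldD(8)[OF df] difference_fieldD(2)[OF df]
      using nz by (intro sum.cong refl) (simp add: \<phi>'_def surj)
    finally show "pairing (\<lambda>f. \<psi> f * \<phi> f) (laurent_sigma \<sigma> p) = 0"
      by (simp add: pairing_laurent_sigma)
  qed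
qed (rule subspace_twisted_kernel[OF psi])

lemma zx_lattice_add_subgroup: "zx_lattice L \<Longrightarrow> add_subgroup L"
  by (simp add: zx_lattice_def add_subgroup_def vec_module.subspace_0 vec_module.subspace_diff)

lemma zx_lattice_scale: "zx_lattice L \<Longrightarrow> f \<in> L \<Longrightarrow> p *s f \<in> L"
  by (simp add: zx_lattice_def vec_module.subspace_scale)

lemma zx_latticeI:
  assumes K: "add_subgroup K" and shift: "\<And>f. f \<in> K \<Longrightarrow> shift f \<in> K"
  shows "zx_lattice K"
  unfolding zx_lattice_def
proof (rule vec_module.subspaceI)
  show "0 \<in> K" "\<And>f g. f \<in> K \<Longrightarrow> g \<in> K \<Longrightarrow> f + g \<in> K" using add_subgroupD[OF K] by auto
  fix p f assume f: "f \<in> K"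
  have nat: "of_nat n *s f \<in> K" for n
    by (induction n) (use add_subgroupD[OF K] f in \<open>auto simp: vec_module.scale_left_distrib\<close>)
  have int: "[:a:] *s f \<in> K" for a :: int
  proof (cases "a \<ge> 0")
    case True
    then obtain n where "a = int n" using nonneg_int_cases by blast
    then have "[:a:] = of_nat n" by (simp add: of_nat_poly)
    then show ?thesis using nat by simp
  next
    case False
    then obtain n where "a = - int n" by (metis nonpos_int_cases linear)
    then have "[:a:] = - of_nat n" by (simp add: of_nat_poly)
    then show ?thesis using add_subgroupD(4)[OF K nat[of n]] by simp
  qed
  show "p *s f \<in> K"
  proof (induction p)
    case 0
    then show ?case using add_subgroupD(1)[OF K] by simp
  next
    case (pCons a p)
    have "pCons a p = [:a:] + [:0, 1:] * p" by simp
    then have "pCons a p *s f = [:a:] *s f + shift (p *s f)"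
      by (simp only: vec_module.scale_left_distrib vec_module.scale_scale)
    then show ?case using add_subgroupD(3)[OF K int shift[OF pCons.IH]] by simp
  qed
qed

text \<open>
  \<open>T\<close> consists of the exponents that are torsion modulo \<open>S\<close>. For a character \<open>\<eta>\<close> extending \<open>\<psi>\<close>
  on \<open>S\<close> and \<open>t \<in> T\<close> with \<open>m t \<in> S\<close>, the number \<open>b = \<eta> t\<close> is an \<open>m\<close>-th root of \<open>\<psi> (m t)\<close>, and
  the compatibility assumption on these roots says precisely that \<open>\<eta> (x t) = \<sigma> (\<eta> t)\<close>. So the
  twisted kernel of \<open>T\<close> and \<open>\<eta>\<close> is a \<open>\<sigma>\<close>-stable prime ideal, which is well-mixed; and the twisted
  kernel of \<open>S\<close> is the intersection of these ideals over all \<open>\<eta>\<close>.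
\<close>

lemma well_mixed_twisted_kernel:
  fixes \<psi> :: "int poly ^ 'n::finite \<Rightarrow> 'a::{alg_closed_field, field_char_0}"
  assumes df: "difference_field \<sigma>" and inv: "inversive \<sigma>"
    and S: "zx_lattice S" "M_saturated \<sigma> \<zeta> S"
    and psi: "character \<psi>" and equi: "\<And>t. t \<in> S \<Longrightarrow> \<psi> (shift t) = \<sigma> (\<psi> t)"
    and comp: "\<And>m f b. m \<ge> 1 \<Longrightarrow> of_nat m *s f \<in> S \<Longrightarrow> b ^ m = \<psi> (of_nat m *s f) \<Longrightarrow>
      \<psi> (([:0, 1:] - of_nat (root_exponent \<sigma> \<zeta> m)) *s f) = \<sigma> b / b ^ root_exponent \<sigma> \<zeta> m"
  shows "well_mixed \<sigma> (twisted_kernel S \<psi>)"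
  unfolding well_mixed_def
proof (intro conjI allI impI)
  note Sg = zx_lattice_add_subgroup[OF S(1)]
  show "sigma_ideal \<sigma> (twisted_kernel S \<psi>)"
    by (rule sigma_ideal_twisted_kernel[OF df inv psi zx_lattice_scale[OF S(1)] equi])
  fix p q assume pq: "p * q \<in> twisted_kernel S \<psi>"
  define T where "T = {f. \<exists>m\<ge>1. of_nat m *s f \<in> S}"
  have "S \<subseteq> T" unfolding T_def by (auto intro!: exI[of _ 1])
  have T: "add_subgroup T"
    unfolding add_subgroup_def
  proof (intro conjI ballI)
    show "0 \<in> T" using \<open>S \<subseteq> T\<close> add_subgroupD(1)[OF Sg] by blast
    fix f g assume "f \<in> T" "g \<in> T"
    then obtain m k where mk: "m \<ge> 1" "of_nat m *s f \<in> S" "k \<ge> 1" "of_nat k *s g \<in> S" by (auto simp: T_def)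
    have "of_nat (m * k) *s (f - g) = of_nat k *s (of_nat m *s f) - of_nat m *s (of_nat k *s g)"
      by (simp add: vec_module.scale_right_diff_distrib mult.commute)
    also have "\<dots> \<in> S" by (intro add_subgroupD(2)[OF Sg] zx_lattice_scale[OF S(1)] mk)
    finally show "f - g \<in> T" using mk(1,3) unfolding T_def by (intro CollectI exI[of _ "m * k"]) auto
  qed
  have pure: "f \<in> T" if m: "m > 0" and mf: "of_nat m *s f \<in> T" for m :: nat and f
  proof -
    obtain k where "k \<ge> 1" "of_nat k *s (of_nat m *s f) \<in> S" using mf by (auto simp: T_def)
    then show ?thesis using m unfolding T_def by (intro CollectI exI[of _ "k * m"]) auto
  qed
  have shiftT: "shift t \<in> T" if "t \<in> T" for t
  proof -
    obtain m where "m \<ge> 1" "of_nat m *s t \<in> S" using \<open>t \<in> T\<close> by (auto simp: T_def)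
    moreover have "of_nat m *s shift t = shift (of_nat m *s t)" by (simp add: mult.commute)
    ultimately show ?thesis using zx_lattice_scale[OF S(1)] unfolding T_def by (metis (mono_tags, lifting) mem_Collect_eq)
  qed
  show "p * laurent_sigma \<sigma> q \<in> twisted_kernel S \<psi>"
  proof (rule twisted_kernel_from_characters[OF Sg psi])
    fix \<eta> :: "int poly ^ 'n \<Rightarrow> 'a" assume eta: "character \<eta>" and ext: "\<And>f. f \<in> S \<Longrightarrow> \<eta> f = \<psi> f"
    have equiT: "\<eta> (shift t) = \<sigma> (\<eta> t)" if t: "t \<in> T" for t
    proof -
      obtain m where m: "m \<ge> 1" "of_nat m *s t \<in> S" using t by (auto simp: T_def)
      let ?o = "root_exponent \<sigma> \<zeta> m" and ?g = "([:0, 1:] - of_nat (root_exponent \<sigma> \<zeta> m)) *s t"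
      have "?g \<in> S" using S(2) m unfolding M_saturated_def by blast
      have b: "\<eta> t ^ m = \<psi> (of_nat m *s t)"
        by (simp only: character_of_nat_scale[OF eta, symmetric] ext[OF m(2)])
      have "shift t = ?g + of_nat ?o *s t" by (simp only: vec_module.scale_left_distrib[symmetric]) simp
      then have "\<eta> (shift t) = \<eta> ?g * \<eta> t ^ ?o"
        by (simp only: characterD(2)[OF eta] character_of_nat_scale[OF eta])
      also have "\<eta> ?g = \<sigma> (\<eta> t) / \<eta> t ^ ?o" using ext[OF \<open>?g \<in> S\<close>] comp[OF m b] by simp
      finally show ?thesis using characterD(1)[OF eta] by simp
    qed
    have TS: "twisted_kernel T \<eta> \<subseteq> {r. pairing \<eta> r = 0}"
    proof
      fix r assume "r \<in> twisted_kernel T \<eta>"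
      from twisted_kernelD[OF this, of "\<lambda>_. 1"] show "r \<in> {r. pairing \<eta> r = 0}" by (simp add: periodic_def)
    qed
    have pqT: "p * q \<in> twisted_kernel T \<eta>"
      unfolding twisted_kernel_def
    proof (intro CollectI allI impI)
      fix \<phi> :: "int poly ^ 'n \<Rightarrow> 'a" assume phi: "periodic T \<phi>"
      have "periodic S (\<lambda>f. \<eta> f / \<psi> f * \<phi> f)"
        using phi ext \<open>S \<subseteq> T\<close> characterD(1)[OF psi]
        by (auto simp: periodic_def characterD(2)[OF psi] characterD(2)[OF eta])
      from twisted_kernelD[OF pq this] show "pairing (\<lambda>f. \<eta> f * \<phi> f) (p * q) = 0"
        using characterD(1)[OF psi] by simp
    qed
    have "p \<in> twisted_kernel T \<eta> \<or> q \<in> twisted_kernel T \<eta>"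
      by (rule twisted_kernel_prime[OF T _ eta pqT]) (rule pure)
    moreover have sid: "sigma_ideal \<sigma> (twisted_kernel T \<eta>)"
      by (rule sigma_ideal_twisted_kernel[OF df inv eta shiftT equiT])
    ultimately have "p \<in> twisted_kernel T \<eta> \<or> laurent_sigma \<sigma> q \<in> twisted_kernel T \<eta>"
      unfolding sigma_ideal_def by blast
    then have "p * laurent_sigma \<sigma> q \<in> twisted_kernel T \<eta>"
      using sid ring_module.subspace_scale unfolding sigma_ideal_def by (metis mult.commute)
    then show "pairing \<eta> (p * laurent_sigma \<sigma> q) = 0" using TS by blast
  qed
qed

section \<open>Binomials in a well-mixed ideal\<close>

lemma binomial_add_mem:
  fixes J :: "('a::field, 'n::finite) laurent set"
  assumes J: "ring_module.subspace J" and "lmonom 1 f - lconst c \<in> J" "lmonom 1 g - lconst d \<in> J"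
  shows "lmonom 1 (f + g) - lconst (c * d) \<in> J"
proof -
  have "lmonom 1 g * (lmonom 1 f - lconst c) + lconst c * (lmonom 1 g - lconst d) \<in> J"
    using assms by (intro ring_module.subspace_add[OF J] ring_module.subspace_scale[OF J])
  then show ?thesis by (simp add: right_diff_distrib mult_single add.commute)
qed

lemma binomial_uminus_mem:
  fixes J :: "('a::field, 'n::finite) laurent set"
  assumes J: "ring_module.subspace J" and "lmonom 1 f - lconst c \<in> J" "c \<noteq> 0"
  shows "lmonom 1 (- f) - lconst (inverse c) \<in> J"
proof -
  have "lmonom (- inverse c) (- f) * (lmonom 1 f - lconst c) \<in> J"
    using assms by (intro ring_module.subspace_scale[OF J])
  then show ?thesis using \<open>c \<noteq> 0\<close> by (simp add: right_diff_distrib mult_single single_uminus)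
qed

lemma binomial_value_unique:
  fixes J :: "('a::field, 'n::finite) laurent set"
  assumes J: "ring_module.subspace J" and "1 \<notin> J"
    and "lmonom 1 f - lconst c \<in> J" "lmonom 1 f - lconst d \<in> J"
  shows "c = d"
proof (rule ccontr)
  assume "c \<noteq> d"
  have "lconst (1 / (d - c)) * ((lmonom 1 f - lconst c) - (lmonom 1 f - lconst d)) \<in> J"
    by (rule ring_module.subspace_scale[OF J ring_module.subspace_diff[OF J assms(3,4)]])
  also have "(lmonom 1 f - lconst c) - (lmonom 1 f - lconst d) = lconst (d - c)"
    by (simp add: single_diff)
  also have "lconst (1 / (d - c)) * lconst (d - c) = 1"
    using \<open>c \<noteq> d\<close> by (simp add: mult_single)
  finally show False using \<open>1 \<notin> J\<close> by blast
qed

lemma support_lattice_zx_lattice: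
  fixes J :: "('a::field, 'n::finite) laurent set"
  assumes df: "difference_field \<sigma>" and J: "sigma_ideal \<sigma> J"
  shows "zx_lattice (support_lattice J)"
proof (rule zx_latticeI)
  have I: "ring_module.subspace J" using J by (simp add: sigma_ideal_def)
  show "add_subgroup (support_lattice J)"
    unfolding add_subgroup_def
  proof (intro conjI ballI)
    have "lmonom 1 0 - lconst 1 \<in> J" using ring_module.subspace_0[OF I] by simp
    then show "0 \<in> support_lattice J" unfolding support_lattice_def using zero_neq_one by (metis (mono_tags, lifting) mem_Collect_eq)
    fix f g assume "f \<in> support_lattice J" "g \<in> support_lattice J"
    then obtain c d where cd: "c \<noteq> 0" "d \<noteq> 0" "lmonom 1 f - lconst c \<in> J" "lmonom 1 g - lconst d \<in> J"
      by (auto simp: support_lattice_def)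
    from binomial_add_mem[OF I cd(3) binomial_uminus_mem[OF I cd(4,2)]]
    show "f - g \<in> support_lattice J"
      using cd(1,2) by (auto simp: support_lattice_def intro!: exI[of _ "c * inverse d"])
  qed
  fix f assume "f \<in> support_lattice J"
  then obtain c where c: "c \<noteq> 0" "lmonom 1 f - lconst c \<in> J" by (auto simp: support_lattice_def)
  then have "lmonom 1 (shift f) - lconst (\<sigma> c) \<in> J"
    using J laurent_sigma_binomial[OF df, of f c] by (metis sigma_ideal_def)
  then show "shift f \<in> support_lattice J"
    using c(1) difference_fieldD(4)[OF df] by (auto simp: support_lattice_def)
qed

lemma lconst_sum: "(\<Sum>x\<in>A. lmonom (c x) f) = lmonom (\<Sum>x\<in>A. c x) f"
  by (induction A rule: infinite_finite_induct) (simp_all add: single_add)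

lemma lmonom_power: "lmonom a f ^ k = lmonom (a ^ k) (of_nat k *s f)"
  by (induction k) (simp_all add: mult_single vec_module.scale_left_distrib flip: single_one)

lemma primitive_root_power_sum:
  fixes z :: "'a::field"
  assumes "primitive_root_of_unity m z" "0 < j" "j < m"
  shows "(\<Sum>k<m. (z ^ k) ^ j) = 0"
proof -
  have 1: "z ^ j \<noteq> 1" "z ^ m = 1" using assms by (auto simp: primitive_root_of_unity_def)
  have swap: "(z ^ k) ^ j = (z ^ j) ^ k" for k by (simp only: power_mult[symmetric] mult.commute)
  have "(z ^ j) ^ m = 1" using swap[of m] 1(2) by simp
  then show ?thesis unfolding swap by (simp add: geometric_sum[OF 1(1)])
qed

text \<open>
  Put \<open>u = Y\<^sup>f\<close>. Modulo \<open>J\<close> the product of \<open>u - z\<^sup>k b\<close> and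
  \<open>e\<^sub>k = (u\<^sup>m - b\<^sup>m) / (u - z\<^sup>k b)\<close> vanishes, and well-mixedness allows \<open>\<sigma>\<close> to be applied to the
  first factor alone. On the component cut out by \<open>e\<^sub>k\<close>, where \<open>u = z\<^sup>k b\<close>, this gives
  \<open>\<sigma> u = z\<^sup>k\<^sup>r \<sigma> b\<close> and therefore \<open>b\<^sup>r \<sigma> u = \<sigma> b u\<^sup>r\<close>. The last relation no longer depends on \<open>k\<close>,
  and the sum of all \<open>e\<^sub>k\<close> is the unit \<open>m u\<^sup>m\<^sup>-\<^sup>1\<close>, so it holds modulo \<open>J\<close>.
\<close>

lemma well_mixed_binomial_root:
  fixes J :: "('a::field_char_0, 'n::finite) laurent set"
  assumes df: "difference_field \<sigma>" and J: "well_mixed \<sigma> J"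
    and z: "primitive_root_of_unity m z" "\<sigma> z = z ^ r" and m: "m \<ge> 1"
    and b: "b \<noteq> 0" "lmonom 1 (of_nat m *s f) - lconst (b ^ m) \<in> J"
  shows "lmonom 1 (([:0, 1:] - of_nat r) *s f) - lconst (\<sigma> b / b ^ r) \<in> J"
proof -
  have I: "ring_module.subspace J" using J by (simp add: well_mixed_def sigma_ideal_def)
  define u :: "('a, 'n) laurent" where "u = lmonom 1 f"
  define u' :: "('a, 'n) laurent" where "u' = lmonom 1 (shift f)"
  define w :: "nat \<Rightarrow> ('a, 'n) laurent" where "w k = lconst (z ^ k * b)" for k
  define e where "e k = (\<Sum>i<m. w k ^ (m - Suc i) * u ^ i)" for k
  define W where "W = lconst (b ^ r) * u' - lconst (\<sigma> b) * u ^ r"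
  have wpow: "w k ^ j = lconst ((z ^ k * b) ^ j)" for k j by (simp add: w_def lmonom_power)
  have zm: "(z ^ k) ^ m = 1" for k
    using z(1) by (metis primitive_root_of_unity_def power_mult mult.commute power_one)
  have e: "(u - w k) * e k \<in> J" for k
  proof -
    have "(u - w k) * e k = u ^ m - w k ^ m" by (simp only: e_def power_diff_sumr2)
    also have "\<dots> = lmonom 1 (of_nat m *s f) - lconst (b ^ m)"
      by (simp add: wpow u_def lmonom_power power_mult_distrib zm)
    finally show ?thesis using b(2) by simp
  qed
  have eW: "e k * W \<in> J" for k
  proof -
    have "e k * (u - w k) \<in> J" using e[of k] by (simp add: mult.commute)
    then have "e k * laurent_sigma \<sigma> (u - w k) \<in> J" using J by (simp add: well_mixed_def)
    also have "laurent_sigma \<sigma> (u - w k) = u' - lconst (z ^ (k * r) * \<sigma> b)"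
      unfolding u_def w_def laurent_sigma_binomial[OF df] difference_fieldD(2,7)[OF df] z(2) u'_def
      by (simp add: power_mult mult.commute[of k])
    finally have 1: "e k * (u' - lconst (z ^ (k * r) * \<sigma> b)) \<in> J" .
    have "e k * (u ^ r - w k ^ r) = (\<Sum>i<r. w k ^ (r - Suc i) * u ^ i) * ((u - w k) * e k)"
      by (simp only: power_diff_sumr2[of u r] mult_ac)
    also have "\<dots> \<in> J" by (rule ring_module.subspace_scale[OF I e])
    also have "w k ^ r = lconst (z ^ (k * r) * b ^ r)"
      by (simp add: wpow power_mult_distrib power_mult)
    finally have 2: "e k * (u ^ r - lconst (z ^ (k * r) * b ^ r)) \<in> J" .
    have "e k * W = lconst (b ^ r) * (e k * (u' - lconst (z ^ (k * r) * \<sigma> b)))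
        - lconst (\<sigma> b) * (e k * (u ^ r - lconst (z ^ (k * r) * b ^ r)))"
    proof -
      have "lconst (b ^ r) * lconst (z ^ (k * r) * \<sigma> b) = lconst (\<sigma> b) * (lconst (z ^ (k * r) * b ^ r) :: ('a, 'n) laurent)"
        by (simp add: mult_single mult_ac)
      moreover have "A * X - B * Y = C" if "A * P = B * Q" "C = A * (X - P) - B * (Y - Q)"
        for A B C P Q X Y :: "('a, 'n) laurent"
        using that by (simp add: algebra_simps)
      moreover have "A * (E * X) - B * (E * Y) = E * (A * X - B * Y)" for A B E X Y :: "('a, 'n) laurent"
        by (simp add: algebra_simps)
      ultimately show ?thesis unfolding W_def by metis
    qed
    then show ?thesis
      using 1 2 by (metis ring_module.subspace_diff[OF I] ring_module.subspace_scale[OF I])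
  qed
  have "(\<Sum>k<m. e k) = (\<Sum>i<m. (\<Sum>k<m. w k ^ (m - Suc i)) * u ^ i)"
    unfolding e_def by (subst sum.swap) (simp add: sum_distrib_right)
  also have "\<dots> = (\<Sum>i<m. if i = m - 1 then lconst (of_nat m) * u ^ (m - 1) else 0)"
  proof (rule sum.cong[OF refl])
    fix i assume i: "i \<in> {..<m}"
    have "(\<Sum>k<m. w k ^ (m - Suc i)) = lconst ((\<Sum>k<m. (z ^ k) ^ (m - Suc i)) * b ^ (m - Suc i))"
      by (simp add: wpow lconst_sum power_mult_distrib sum_distrib_right)
    then show "(\<Sum>k<m. w k ^ (m - Suc i)) * u ^ i = (if i = m - 1 then lconst (of_nat m) * u ^ (m - 1) else 0)"
      using primitive_root_power_sum[OF z(1), of "m - Suc i"] i by auto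
  qed
  also have "\<dots> = lconst (of_nat m) * u ^ (m - 1)" using m by simp
  finally have sum_e: "(\<Sum>k<m. e k) = lconst (of_nat m) * u ^ (m - 1)" .
  have "(\<Sum>k<m. e k) * W \<in> J"
    unfolding sum_distrib_right by (rule ring_module.subspace_sum[OF I]) (rule eW)
  then have mW: "lconst (of_nat m) * u ^ (m - 1) * W \<in> J" by (simp only: sum_e)
  \<comment> \<open>\<open>v\<close> is the inverse of the unit \<open>m u\<^sup>m\<^sup>-\<^sup>1\<close> times \<open>b\<^sup>r u\<^sup>r\<close>; the latter normalizes the binomial \<open>W\<close>.\<close>
  define v :: "('a, 'n) laurent"
    where "v = lmonom (1 / (of_nat m * b ^ r)) (- (of_nat (m - 1) *s f) - of_nat r *s f)"
  have "v * (lconst (of_nat m) * u ^ (m - 1) * W) \<in> J" by (rule ring_module.subspace_scale[OF I mW])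
  also have "v * (lconst (of_nat m) * u ^ (m - 1) * W) = lmonom (1 / b ^ r) (- (of_nat r *s f)) * W"
  proof -
    have "v * (lconst (of_nat m) * u ^ (m - 1)) =
        lmonom (1 / (of_nat m * b ^ r) * (of_nat m * 1 ^ (m - 1)))
          (- (of_nat (m - 1) *s f) - of_nat r *s f + (0 + of_nat (m - 1) *s f))"
      by (simp only: v_def u_def lmonom_power mult_single)
    also have "1 / (of_nat m * b ^ r) * (of_nat m * 1 ^ (m - 1)) = 1 / b ^ r" using m by simp
    also have "- (of_nat (m - 1) *s f) - of_nat r *s f + (0 + of_nat (m - 1) *s f) = - (of_nat r *s f)"
      by simp
    finally show ?thesis by (simp only: mult.assoc[symmetric])
  qed
  also have "\<dots> = lmonom 1 (([:0, 1:] - of_nat r) *s f) - lconst (\<sigma> b / b ^ r)"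
    using b(1) by (simp add: W_def u_def u'_def lmonom_power mult_single right_diff_distrib
        mult.assoc[symmetric] vec_module.scale_left_diff_distrib)
  finally show ?thesis .
qed

section \<open>The well-mixed closure of a character ideal\<close>

lemma sigma_ideal_Inter: "(\<And>I. I \<in> \<C> \<Longrightarrow> sigma_ideal \<sigma> I) \<Longrightarrow> sigma_ideal \<sigma> (\<Inter>\<C>)"
  by (auto simp: sigma_ideal_def intro!: ring_module.subspace_Inter)

lemma well_mixed_Inter: "(\<And>I. I \<in> \<C> \<Longrightarrow> well_mixed \<sigma> I) \<Longrightarrow> well_mixed \<sigma> (\<Inter>\<C>)"
  by (auto simp: well_mixed_def intro!: sigma_ideal_Inter)

lemma sat_M_props:
  "zx_lattice (sat_M \<sigma> \<zeta> L)" "M_saturated \<sigma> \<zeta> (sat_M \<sigma> \<zeta> L)" "L \<subseteq> sat_M \<sigma> \<zeta> L"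
proof -
  have "zx_lattice (sat_M \<sigma> \<zeta> L) \<and> M_saturated \<sigma> \<zeta> (sat_M \<sigma> \<zeta> L)"
    unfolding sat_M_def
    by (rule hull_in) (auto simp: zx_lattice_def M_saturated_def intro!: vec_module.subspace_Inter)
  then show "zx_lattice (sat_M \<sigma> \<zeta> L)" "M_saturated \<sigma> \<zeta> (sat_M \<sigma> \<zeta> L)" by auto
  show "L \<subseteq> sat_M \<sigma> \<zeta> L" unfolding sat_M_def by (rule hull_subset)
qed

lemma primitive_root_sigma:
  fixes \<sigma> :: "'a::field \<Rightarrow> 'a"
  assumes df: "difference_field \<sigma>" and zeta: "\<And>m. m \<ge> 2 \<Longrightarrow> primitive_root_of_unity m (\<zeta> m)" and m: "m \<ge> 1"
  obtains z where "primitive_root_of_unity m z" "\<sigma> z = z ^ root_exponent \<sigma> \<zeta> m"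
proof (cases "m = 1")
  case True
  then show thesis
    using difference_fieldD(3)[OF df] by (intro that[of 1]) (auto simp: primitive_root_of_unity_def)
next
  case False
  then have prim: "primitive_root_of_unity m (\<zeta> m)" using m zeta by simp
  have "\<sigma> (\<zeta> m) = \<zeta> m ^ root_exponent \<sigma> \<zeta> m"
    using theI'[OF root_exponent_ex1[OF df m prim]] False by (simp add: root_exponent_def)
  then show thesis using that prim by blast
qed

theorem theorem4p46:
  fixes \<sigma> :: "'a::{alg_closed_field, field_char_0} \<Rightarrow> 'a"
    and \<zeta> :: "nat \<Rightarrow> 'a"
    and L :: "(int poly ^ 'n) set"
    and \<rho> :: "int poly ^ 'n \<Rightarrow> 'a"
  assumes "difference_field \<sigma>"
    and "inversive \<sigma>"
    and "\<And>m. m \<ge> 2 \<Longrightarrow> primitive_root_of_unity m (\<zeta> m)"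
    and "partial_character \<sigma> L \<rho>"
  shows "well_mixed_closure \<sigma> (character_ideal \<sigma> L \<rho>) = sigma_ideal_generated \<sigma> {1} \<or>
         (laurent_binomial_sigma_ideal \<sigma> (well_mixed_closure \<sigma> (character_ideal \<sigma> L \<rho>)) \<and>
          support_lattice (well_mixed_closure \<sigma> (character_ideal \<sigma> L \<rho>)) = sat_M \<sigma> \<zeta> L)"
proof -
  note df = assms(1) and inv = assms(2)
  define J where "J = well_mixed_closure \<sigma> (character_ideal \<sigma> L \<rho>)"
  have J: "well_mixed \<sigma> J"
    unfolding J_def well_mixed_closure_def by (rule hull_in) (auto intro: well_mixed_Inter)
  then have JS: "sigma_ideal \<sigma> J" and JI: "ring_module.subspace J"
    by (auto simp: well_mixed_def sigma_ideal_def)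
  have gensL: "lmonom 1 f - lconst (\<rho> f) \<in> J" if "f \<in> L" for f
    using that hull_subset[of "character_ideal \<sigma> L \<rho>" "well_mixed \<sigma>"]
      hull_subset[of "(\<lambda>f. lmonom 1 f - lconst (\<rho> f)) ` L" "sigma_ideal \<sigma>"]
    unfolding J_def well_mixed_closure_def character_ideal_def sigma_ideal_generated_def by blast
  show ?thesis
    unfolding J_def[symmetric]
  proof (cases "1 \<in> J")
    case True
    have full: "I = UNIV" if "ring_module.subspace I" "1 \<in> I" for I :: "('a, 'n) laurent set"
      using ring_module.subspace_scale[OF that] by auto
    have "sigma_ideal \<sigma> (sigma_ideal_generated \<sigma> {1 :: ('a, 'n) laurent})"
      unfolding sigma_ideal_generated_def by (rule hull_in) (auto intro: sigma_ideal_Inter)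
    moreover have "1 \<in> sigma_ideal_generated \<sigma> {1 :: ('a, 'n) laurent}"
      unfolding sigma_ideal_generated_def by (rule hull_inc) simp
    ultimately have "J = sigma_ideal_generated \<sigma> {1}"
      using full[OF JI True] full[of "sigma_ideal_generated \<sigma> {1}"] by (simp add: sigma_ideal_def)
    then show "J = sigma_ideal_generated \<sigma> {1} \<or>
      laurent_binomial_sigma_ideal \<sigma> J \<and> support_lattice J = sat_M \<sigma> \<zeta> L" ..
  next
    case False
    note unique = binomial_value_unique[OF JI False]
    define S where "S = sat_M \<sigma> \<zeta> L"
    note S = sat_M_props[where \<sigma> = \<sigma> and \<zeta> = \<zeta> and L = L, folded S_def]
    note Sg = zx_lattice_add_subgroup[OF S(1)]
    have root: "lmonom 1 (([:0, 1:] - of_nat (root_exponent \<sigma> \<zeta> m)) *s f)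
        - lconst (\<sigma> b / b ^ root_exponent \<sigma> \<zeta> m) \<in> J"
      if "m \<ge> 1" "b \<noteq> 0" "lmonom 1 (of_nat m *s f) - lconst (b ^ m) \<in> J" for m f b
    proof -
      obtain z where "primitive_root_of_unity m z" "\<sigma> z = z ^ root_exponent \<sigma> \<zeta> m"
        using primitive_root_sigma[OF df assms(3) \<open>m \<ge> 1\<close>] by metis
      from well_mixed_binomial_root[OF df J this that] show ?thesis .
    qed
    have "M_saturated \<sigma> \<zeta> (support_lattice J)"
      unfolding M_saturated_def
    proof (intro allI impI)
      fix m :: nat and f assume m: "m \<ge> 1" and "of_nat m *s f \<in> support_lattice J"
      then obtain c where c: "c \<noteq> 0" "lmonom 1 (of_nat m *s f) - lconst c \<in> J"
        by (auto simp: support_lattice_def)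
      obtain b where b: "b ^ m = c" using nth_root_exists[of m c] m by auto
      then have "b \<noteq> 0" using c(1) m by (auto simp: power_0_left)
      moreover have "\<sigma> b / b ^ root_exponent \<sigma> \<zeta> m \<noteq> 0"
        using \<open>b \<noteq> 0\<close> difference_fieldD(4)[OF df] by simp
      ultimately show "([:0, 1:] - of_nat (root_exponent \<sigma> \<zeta> m)) *s f \<in> support_lattice J"
        using root[OF m, of b f] c(2) b unfolding support_lattice_def by blast
    qed
    moreover have "L \<subseteq> support_lattice J"
      using gensL assms(4) unfolding support_lattice_def partial_character_def by blast
    ultimately have SJ: "S \<subseteq> support_lattice J"
      unfolding S_def sat_M_def using support_lattice_zx_lattice[OF df JS] by (intro hull_minimal) auto
    define \<tau> where "\<tau> f = (SOME c. c \<noteq> 0 \<and> lmonom 1 f - lconst c \<in> J)" for f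
    have tau: "\<tau> f \<noteq> 0" "lmonom 1 f - lconst (\<tau> f) \<in> J" if "f \<in> S" for f
    proof -
      have "\<exists>c. c \<noteq> 0 \<and> lmonom 1 f - lconst c \<in> J" using SJ that by (auto simp: support_lattice_def)
      from someI_ex[OF this] show "\<tau> f \<noteq> 0" "lmonom 1 f - lconst (\<tau> f) \<in> J" by (auto simp: \<tau>_def)
    qed
    have "character_on S \<tau>"
      unfolding character_on_def
    proof (intro conjI ballI)
      fix f g assume fg: "f \<in> S" "g \<in> S"
      show "\<tau> f \<noteq> 0" by (rule tau(1)[OF fg(1)])
      show "\<tau> (f + g) = \<tau> f * \<tau> g"
        by (rule unique[OF tau(2)[OF add_subgroupD(3)[OF Sg fg]]
              binomial_add_mem[OF JI tau(2)[OF fg(1)] tau(2)[OF fg(2)]]])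
    qed
    then obtain \<psi> where psi: "character \<psi>" and psi_tau: "\<And>f. f \<in> S \<Longrightarrow> \<psi> f = \<tau> f"
      using character_extends[OF Sg] by metis
    have gens: "lmonom 1 f - lconst (\<psi> f) \<in> J" if "f \<in> S" for f using tau(2)[OF that] psi_tau[OF that] by simp
    have psi_unique: "\<psi> f = c" if "f \<in> S" "lmonom 1 f - lconst c \<in> J" for f c
      using unique[OF gens[OF that(1)] that(2)] .
    have equi: "\<psi> (shift t) = \<sigma> (\<psi> t)" if "t \<in> S" for t
    proof (rule psi_unique)
      show "shift t \<in> S" by (rule zx_lattice_scale[OF S(1) that])
      show "lmonom 1 (shift t) - lconst (\<sigma> (\<psi> t)) \<in> J"
        using JS gens[OF that] laurent_sigma_binomial[OF df, of t "\<psi> t"] by (metis sigma_ideal_def)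
    qed
    \<comment> \<open>\<open>D\<close> lies in \<open>J\<close> and contains the generators, so it is \<open>J\<close> once it is well-mixed.\<close>
    define D where "D = twisted_kernel S \<psi>"
    have D: "well_mixed \<sigma> D"
      unfolding D_def
    proof (rule well_mixed_twisted_kernel[OF df inv S(1,2) psi equi])
      fix m :: nat and f b
      assume m: "m \<ge> 1" "of_nat m *s f \<in> S" and b: "b ^ m = \<psi> (of_nat m *s f)"
      have "b \<noteq> 0" using b m(1) characterD(1)[OF psi, of "of_nat m *s f"] by (auto simp: power_0_left)
      show "\<psi> (([:0, 1:] - of_nat (root_exponent \<sigma> \<zeta> m)) *s f) = \<sigma> b / b ^ root_exponent \<sigma> \<zeta> m"
      proof (rule psi_unique)
        show "([:0, 1:] - of_nat (root_exponent \<sigma> \<zeta> m)) *s f \<in> S"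
          using S(2) m unfolding M_saturated_def by blast
        show "lmonom 1 (([:0, 1:] - of_nat (root_exponent \<sigma> \<zeta> m)) *s f)
            - lconst (\<sigma> b / b ^ root_exponent \<sigma> \<zeta> m) \<in> J"
          by (rule root[OF m(1) \<open>b \<noteq> 0\<close>]) (use gens[OF m(2)] b in simp)
      qed
    qed
    then have DS: "sigma_ideal \<sigma> D" by (simp add: well_mixed_def)
    have inD: "lmonom 1 f - lconst (\<psi> f) \<in> D" if "f \<in> S" for f
      unfolding D_def using binomial_in_twisted_kernel_iff[OF Sg psi] characterD(1)[OF psi] that by blast
    have D_least: "D \<subseteq> I" if "ring_module.subspace I" "\<And>f. f \<in> S \<Longrightarrow> lmonom 1 f - lconst (\<psi> f) \<in> I" for I
      unfolding D_def by (rule twisted_kernel_subset_ideal[OF Sg psi that])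
    have "J \<subseteq> D"
      unfolding J_def well_mixed_closure_def
    proof (rule hull_minimal)
      show "well_mixed \<sigma> D" by (rule D)
      have "lmonom 1 f - lconst (\<rho> f) \<in> D" if "f \<in> L" for f
        using inD[of f] psi_unique[OF _ gensL[OF that]] S(3) that by auto
      then show "character_ideal \<sigma> L \<rho> \<subseteq> D"
        unfolding character_ideal_def sigma_ideal_generated_def by (intro hull_minimal DS) auto
    qed
    moreover have "D \<subseteq> J" by (rule D_least[OF JI gens])
    ultimately have JD: "J = D" by (rule subset_antisym)
    have "laurent_binomial_sigma_ideal \<sigma> J"
      unfolding laurent_binomial_sigma_ideal_def
    proof (intro exI conjI)
      let ?B = "(\<lambda>f. lmonom 1 f - lconst (\<psi> f)) ` S"
      show "?B \<subseteq> {lmonom a g + lmonom b h | a b g h. True}"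
      proof (rule image_subsetI)
        fix f
        have "lmonom 1 f - lconst (\<psi> f) = lmonom 1 f + lmonom (- \<psi> f) 0" by (simp add: single_uminus)
        then show "lmonom 1 f - lconst (\<psi> f) \<in> {lmonom a g + lmonom b h | a b g h. True}" by blast
      qed
      show "J = sigma_ideal_generated \<sigma> ?B"
        unfolding sigma_ideal_generated_def JD
      proof (rule hull_unique[symmetric])
        show "?B \<subseteq> D" using inD by auto
        show "\<And>I. ?B \<subseteq> I \<Longrightarrow> sigma_ideal \<sigma> I \<Longrightarrow> D \<subseteq> I"
          by (rule D_least) (auto simp: sigma_ideal_def)
      qed (rule DS)
    qed
    moreover have "support_lattice J = S"
      unfolding JD D_def support_lattice_def
      using binomial_in_twisted_kernel_iff[OF Sg psi] characterD(1)[OF psi] by blast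
    ultimately show "J = sigma_ideal_generated \<sigma> {1} \<or>
      laurent_binomial_sigma_ideal \<sigma> J \<and> support_lattice J = sat_M \<sigma> \<zeta> L"
      by (simp add: S_def)
  qed
qed

end
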